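(* Let $\Lambda=M\mathbb{Z}^d\subset\mathbb{R}^d$ be a full lattice with dual lattice $\Lambda^*$ and fundamental domain $\Pi_\Lambda$, let $k\geq 1$ be an integer, and let $\Omega\subset\mathbb{R}^d$ be a measurable set with $0<|\Omega|<\infty$ that is a $k$-tile for $\Lambda$. Fix a partition $\Omega=\Omega_1\cup\dots\cup\Omega_k\cup E$ with $|E|=0$ and $\Omega_1,\dots,\Omega_k$ mutually disjoint measurable fundamental domains of $\Lambda$, and for almost every $x\in\Pi_\Lambda$ and $1\leq r\leq k$ let $\lambda_r(x)\in\Lambda$ be the unique lattice point with $x+\lambda_r(x)\in\Omega_r$, and let $\omega_r(x)=x+\lambda_r(x)$. Suppose there exist vectors $a_1,\dots,a_k\in\mathbb{R}^d$ and constants $0<\alpha\le\beta<\infty$ such that the matrix function $V(x)\in\mathbb{C}^{k\times k}$ with entries $$(V(x))_{sr}=e^{-2\pi i\,\lambda_r(x)\cdot a_s},\qquad 1\leq s,r\leq k,$$ has all its singular values satisfying $\alpha<\sigma_i(V(x))<\beta$, $1\leq i\leq k$, for almost every $x\in\Pi_\Lambda$. Let $L=\bigcup_{s=1}^k(\Lambda^*+a_s)$ and, for $\lambda^*\in\Lambda^*$ and $1\leq s\leq k$, define on $\Omega$ (almost everywhere) $$g_{\lambda^*+a_s}(x)=e_{\lambda^*+a_s}(x)\left(k\sum_{r=1}^k \big(V(\omega_r^{-1}(x))\big)_{sr}\,\big(V(\omega_r^{-1}(x))^{-1}\big)_{rs}\,\chi_{\Omega_r}(x)\right),$$ where $e_l(x)=e^{2\pi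 i l\cdot x}$ and $\chi_{\Omega_r}$ is the indicator function of $\Omega_r$ (the $r$-th summand is $0$ for $x\notin\Omega_r$). Then $\{e_l\}_{l\in L}$ and $\{g_l\}_{l\in L}$ form a pair of biorthogonal Riesz bases for $L^2(\Omega)$.
   Context: Lattice notation: $M\in\mathbb{R}^{d\times d}$ is invertible, $\Lambda=M\mathbb{Z}^d$, $\Lambda^*=M^{-T}\mathbb{Z}^d$, and $\Pi_\Lambda=M[0,1)^d$. $k$-tile: a measurable set $\Omega\subset\mathbb{R}^d$ of finite positive measure is a $k$-tile for $\Lambda$ if $\sum_{\lambda\in\Lambda}\chi_\Omega(x-\lambda)=k$ for almost every $x\in\mathbb{R}^d$. For such $\Omega$ a partition $\Omega=\Omega_1\cup\dots\cup\Omega_k\cup E$ as in the statement always exists (known). Here a fundamental domain of $\Lambda$ is a measurable set $D$ such that for almost every $x\in\mathbb{R}^d$ there is exactly one $\lambda\in\Lambda$ with $x+\lambda\in D$. Each map $\omega_r:\Pi_\Lambda\to\Omega_r$ is invertible up to null sets; $\omega_r^{-1}$ denotes its inverse. Riesz basis: a countable family $\{h_l\}_{l\in L}\subset L^2(\Omega)$ is a Riesz basis for $L^2(\Omega)$ if every $f\in L^2(\Omega)$ has a unique representation $f=\sum_{l\in L}c_lh_l$ (convergence in $L^2(\Omega)$) with $\{c_l\}\in\ell^2(L)$, and there are constants $0<A\leq B<\infty$, independent of $f$, with $A\|f\|_{L^2(\Omega)}^2\leq\sum_{l\in L}|c_l|^2\leq B\|f\|_{L^2(\Omega)}^2$. Biorthogonal: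 Riesz bases $\{e_l\}_{l\in L}$ and $\{g_l\}_{l\in L}$ are biorthogonal if $\langle e_l,g_{l'}\rangle=|\Omega|$ when $l=l'$ and $\langle e_l,g_{l'}\rangle=0$ otherwise, where $\langle f,g\rangle=\int_\Omega f\overline{g}\,dx$. *)

theory Defs
  imports "HOL-Analysis.Analysis"
begin

section \<open>Lattices and tilings\<close>

definition lattice :: "real^'d^'d \<Rightarrow> (real^'d) set" where
  "lattice M = {M *v z | z. \<forall>i. z $ i \<in> \<int>}"

definition dual_lattice :: "real^'d^'d \<Rightarrow> (real^'d) set" where
  "dual_lattice M = lattice (transpose (matrix_inv M))"

definition fund_parallelepiped :: "real^'d^'d \<Rightarrow> (real^'d) set" where
  "fund_parallelepiped M = {M *v t | t. \<forall>i. 0 \<le> t $ i \<and> t $ i < 1}"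

definition k_tile :: "nat \<Rightarrow> (real^'d) set \<Rightarrow> (real^'d) set \<Rightarrow> bool" where
  "k_tile k \<Lambda> \<Omega> \<longleftrightarrow>
     \<Omega> \<in> sets lebesgue \<and> 0 < emeasure lebesgue \<Omega> \<and> emeasure lebesgue \<Omega> < \<infinity> \<and>
     (AE x in lebesgue. ((\<lambda>l. indicator \<Omega> (x - l) :: real) has_sum real k) \<Lambda>)"

definition fundamental_domain :: "(real^'d) set \<Rightarrow> (real^'d) set \<Rightarrow> bool" where
  "fundamental_domain \<Lambda> D \<longleftrightarrow>
     D \<in> sets lebesgue \<and> (AE x in lebesgue. \<exists>!l. l \<in> \<Lambda> \<and> x + l \<in> D)"

text \<open>
  The value 0 is used on the null set of points where the lattice point is not unique, so that
  the map \<open>shift_into\<close> below sends that null set to itself rather than to an arbitrary set.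
\<close>
definition lattice_shift :: "(real^'d) set \<Rightarrow> (real^'d) set \<Rightarrow> real^'d \<Rightarrow> real^'d" where
  "lattice_shift \<Lambda> D x =
     (if \<exists>!l. l \<in> \<Lambda> \<and> x + l \<in> D then THE l. l \<in> \<Lambda> \<and> x + l \<in> D else 0)"

definition shift_into :: "(real^'d) set \<Rightarrow> (real^'d) set \<Rightarrow> real^'d \<Rightarrow> real^'d" where
  "shift_into \<Lambda> D x = x + lattice_shift \<Lambda> D x"

definition shift_back :: "real^'d^'d \<Rightarrow> (real^'d) set \<Rightarrow> real^'d \<Rightarrow> real^'d" where
  "shift_back M D = the_inv_into (fund_parallelepiped M) (shift_into (lattice M) D)"

section \<open>Exponentials and singular values\<close>

definition expo :: "real^'d \<Rightarrow> real^'d \<Rightarrow> complex" where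
  "expo l x = exp (2 * of_real pi * \<i> * of_real (l \<bullet> x))"

text \<open>The index type \<open>'k\<close> stands for \<open>{1, \<dots>, k}\<close>; \<open>s\<close> is the row and \<open>r\<close> the column index.\<close>
definition V_matrix ::
  "(real^'d) set \<Rightarrow> ('k::finite \<Rightarrow> (real^'d) set) \<Rightarrow> ('k \<Rightarrow> real^'d) \<Rightarrow> real^'d \<Rightarrow> complex^'k^'k" where
  "V_matrix \<Lambda> D a x =
     (\<chi> s r. exp (- 2 * of_real pi * \<i> * of_real (lattice_shift \<Lambda> (D r) x \<bullet> a s)))"

definition conj_transpose :: "complex^'n^'m \<Rightarrow> complex^'m^'n" where
  "conj_transpose A = map_matrix cnj (transpose A)"

text \<open>Square roots of the eigenvalues of \<open>A\<^sup>* A\<close>, as a set, i.e. without multiplicities.\<close>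
definition singular_values :: "complex^'n^'n \<Rightarrow> real set" where
  "singular_values A =
     {\<sigma>. 0 \<le> \<sigma> \<and> (\<exists>v. v \<noteq> 0 \<and> (conj_transpose A ** A) *v v = of_real (\<sigma>\<^sup>2) *s v)}"

section \<open>Riesz bases\<close>

definition L2_fun :: "'a measure \<Rightarrow> ('a \<Rightarrow> complex) set" where
  "L2_fun N = {f \<in> borel_measurable N. integrable N (\<lambda>x. (cmod (f x))\<^sup>2)}"

definition L2_norm_on :: "'a measure \<Rightarrow> ('a \<Rightarrow> complex) \<Rightarrow> real" where
  "L2_norm_on N f = sqrt (LINT x|N. (cmod (f x))\<^sup>2)"

definition L2_inner_on :: "'a measure \<Rightarrow> ('a \<Rightarrow> complex) \<Rightarrow> ('a \<Rightarrow> complex) \<Rightarrow> complex" where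
  "L2_inner_on N f g = (LINT x|N. f x * cnj (g x))"

text \<open>
  The index set carries no order, so convergence is along the finite subsets of \<open>I\<close>
  (unconditional convergence). The coefficients are set to 0 outside \<open>I\<close> so that
  uniqueness of the coefficient family can be expressed by \<open>\<exists>!\<close>.
\<close>
definition l2_expansion ::
  "'a measure \<Rightarrow> 'i set \<Rightarrow> ('i \<Rightarrow> 'a \<Rightarrow> complex) \<Rightarrow> ('a \<Rightarrow> complex) \<Rightarrow> ('i \<Rightarrow> complex) \<Rightarrow> bool" where
  "l2_expansion N I h f c \<longleftrightarrow>
     (\<forall>l. l \<notin> I \<longrightarrow> c l = 0) \<and>
     (\<lambda>l. (cmod (c l))\<^sup>2) summable_on I \<and>
     ((\<lambda>F. L2_norm_on N (\<lambda>x. f x - (\<Sum>l\<in>F. c l * h l x))) \<longlongrightarrow> 0) (finite_subsets_at_top I)"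

definition riesz_basis :: "'a measure \<Rightarrow> 'i set \<Rightarrow> ('i \<Rightarrow> 'a \<Rightarrow> complex) \<Rightarrow> bool" where
  "riesz_basis N I h \<longleftrightarrow>
     countable I \<and> (\<forall>l\<in>I. h l \<in> L2_fun N) \<and>
     (\<forall>f\<in>L2_fun N. \<exists>!c. l2_expansion N I h f c) \<and>
     (\<exists>A B. 0 < A \<and> A \<le> B \<and>
        (\<forall>f\<in>L2_fun N. \<forall>c. l2_expansion N I h f c \<longrightarrow>
           A * (L2_norm_on N f)\<^sup>2 \<le> (\<Sum>\<^sub>\<infinity>l\<in>I. (cmod (c l))\<^sup>2) \<and>
           (\<Sum>\<^sub>\<infinity>l\<in>I. (cmod (c l))\<^sup>2) \<le> B * (L2_norm_on N f)\<^sup>2))"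

definition biorthogonal ::
  "'a::euclidean_space set \<Rightarrow> 'i set \<Rightarrow> ('i \<Rightarrow> 'a \<Rightarrow> complex) \<Rightarrow> ('i \<Rightarrow> 'a \<Rightarrow> complex) \<Rightarrow> bool" where
  "biorthogonal \<Omega> I e g \<longleftrightarrow>
     (\<forall>l\<in>I. \<forall>l'\<in>I. L2_inner_on (lebesgue_on \<Omega>) (e l) (g l') =
        (if l = l' then of_real (measure lebesgue \<Omega>) else 0))"

end

theory Submission
  imports Defs
begin

text \<open>
  Folding \<open>\<Omega>\<close> onto the cell of the lattice identifies \<open>L\<^sup>2(\<Omega>)\<close> with the \<open>k\<close>-fold power of the
  \<open>L\<^sup>2\<close> space of the cell: a function \<open>f\<close> corresponds to the vector of the functions \<open>f \<circ> \<omega>\<^sub>r\<close>.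
  Under this unitary map both families take the form \<open>W(y)\<^sub>r\<^sub>s e\<^sub>\<lambda>(y)\<close> with a matrix function \<open>W\<close> that
  is bounded with bounded inverse because the singular values of \<open>V\<close> are: up to unimodular factors
  \<open>W\<close> is the conjugate transpose of \<open>V\<close> for the exponentials and \<open>k\<close> times the inverse of \<open>V\<close> for
  the dual family. So each of them is the image, under an invertible multiplication operator, of the
  orthogonal basis \<open>e\<^sub>\<lambda>\<close> in each of the \<open>k\<close> components, and the biorthogonality relation is
  \<open>V V\<^sup>-\<^sup>1 = 1\<close>.
\<close>

section \<open>Orthogonal and Riesz bases\<close>

text \<open>For an orthogonal family the squared error of a finite expansion is known exactly, and
  passing to a matrix function with bounded entries and bounded inverse changes it only by bounded
  factors; existence, uniqueness and both Riesz constants are read off from this comparison alone.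
  Two obstacles shape the rest. First, the shifts into \<Omega>_r, the inverse of V and the family
  \<open>g\<close> are controlled only almost everywhere, so the shifts are replaced by maps into
  \<Omega>_r defined without exception, and completeness of Lebesgue measure recovers measurability.
  Second, the exponentials of the dual lattice must be dense in L2 of the half-open cell:
  Stone-Weierstrass works on the compact torus, and cutoffs vanishing on the boundary of the cell
  produce functions that descend to it. The factor k in \<open>g\<close> is the ratio of the volumes
  of \<Omega> and the cell, and the unimodular factor V_sr there cancels the conjugate entry that an
  exponential picks up when it is moved from the cell to \<Omega>_r. Distinct pairs of a dual
  lattice vector and an index s give distinct frequencies, since a coincidence would give V two
  equal rows.\<close>

lemma cmod_add_square_le: "(cmod (a + b))\<^sup>2 \<le> 2 * (cmod a)\<^sup>2 + 2 * (cmod b)\<^sup>2"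
proof -
  have "(cmod (a + b))\<^sup>2 \<le> (cmod a + cmod b)\<^sup>2"
    by (intro power_mono norm_triangle_ineq) auto
  also have "\<dots> \<le> 2 * (cmod a)\<^sup>2 + 2 * (cmod b)\<^sup>2"
    using sum_squares_bound[of "cmod a" "cmod b"] by (simp add: power2_sum)
  finally show ?thesis .
qed

lemma borel_measurable_cnj [measurable (raw)]:
  "f \<in> borel_measurable N \<Longrightarrow> (\<lambda>x. cnj (f x)) \<in> borel_measurable N"
  by (rule borel_measurable_continuous_on[where f = cnj]) (auto intro!: continuous_intros)

lemma L2_fun_measurable: "f \<in> L2_fun N \<Longrightarrow> f \<in> borel_measurable N"
  by (simp add: L2_fun_def)

lemma L2_fun_integrable: "f \<in> L2_fun N \<Longrightarrow> integrable N (\<lambda>x. (cmod (f x))\<^sup>2)"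
  by (simp add: L2_fun_def)

lemma L2_fun_dominated:
  assumes "f \<in> borel_measurable N" "integrable N b" "AE x in N. (cmod (f x))\<^sup>2 \<le> b x"
  shows "f \<in> L2_fun N"
proof -
  have "integrable N (\<lambda>x. (cmod (f x))\<^sup>2)"
    by (rule Bochner_Integration.integrable_bound[OF assms(2)]) (use assms in auto)
  then show ?thesis using assms by (simp add: L2_fun_def)
qed

lemma L2_fun_bounded_times:
  assumes f: "f \<in> L2_fun N" and w: "w \<in> borel_measurable N" "AE x in N. cmod (w x) \<le> K"
  shows "(\<lambda>x. w x * f x) \<in> L2_fun N"
proof (rule L2_fun_dominated)
  show "(\<lambda>x. w x * f x) \<in> borel_measurable N"
    using f w(1) by (auto dest: L2_fun_measurable)
  show "integrable N (\<lambda>x. K\<^sup>2 * (cmod (f x))\<^sup>2)"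
    using L2_fun_integrable[OF f] by simp
  show "AE x in N. (cmod (w x * f x))\<^sup>2 \<le> K\<^sup>2 * (cmod (f x))\<^sup>2"
    using w(2) by eventually_elim
      (auto simp: norm_mult power_mult_distrib intro!: mult_right_mono power_mono)
qed

lemma L2_fun_cmult: "f \<in> L2_fun N \<Longrightarrow> (\<lambda>x. c * f x) \<in> L2_fun N"
  by (rule L2_fun_bounded_times[where K = "cmod c"]) auto

lemma L2_fun_add:
  assumes f: "f \<in> L2_fun N" and g: "g \<in> L2_fun N"
  shows "(\<lambda>x. f x + g x) \<in> L2_fun N"
proof (rule L2_fun_dominated)
  show "integrable N (\<lambda>x. 2 * (cmod (f x))\<^sup>2 + 2 * (cmod (g x))\<^sup>2)"
    using L2_fun_integrable[OF f] L2_fun_integrable[OF g] by simp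
qed (use f g in \<open>auto dest!: L2_fun_measurable intro: cmod_add_square_le\<close>)

lemma L2_fun_diff:
  assumes "f \<in> L2_fun N" "g \<in> L2_fun N"
  shows "(\<lambda>x. f x - g x) \<in> L2_fun N"
  using L2_fun_add[OF assms(1) L2_fun_cmult[OF assms(2), of "-1"]] by simp

lemma L2_fun_sum:
  assumes "\<And>i. i \<in> F \<Longrightarrow> f i \<in> L2_fun N"
  shows "(\<lambda>x. \<Sum>i\<in>F. f i x) \<in> L2_fun N"
  using assms
proof (induction F rule: infinite_finite_induct)
  case (insert i F)
  then show ?case by (simp add: L2_fun_add)
qed (auto simp: L2_fun_def)

lemma L2_fun_integrable_inner:
  assumes f: "f \<in> L2_fun N" and g: "g \<in> L2_fun N"
  shows "integrable N (\<lambda>x. f x * cnj (g x))"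
proof (rule Bochner_Integration.integrable_bound)
  show "integrable N (\<lambda>x. (cmod (f x))\<^sup>2 + (cmod (g x))\<^sup>2)"
    using L2_fun_integrable[OF f] L2_fun_integrable[OF g] by simp
  show "AE x in N. norm (f x * cnj (g x)) \<le> norm ((cmod (f x))\<^sup>2 + (cmod (g x))\<^sup>2)"
  proof (rule AE_I2)
    fix x
    have "2 * (cmod (f x) * cmod (g x)) \<le> (cmod (f x))\<^sup>2 + (cmod (g x))\<^sup>2"
      using sum_squares_bound[of "cmod (f x)" "cmod (g x)"] by (simp add: mult.assoc)
    moreover have "0 \<le> cmod (f x) * cmod (g x)" by simp
    ultimately have "cmod (f x) * cmod (g x) \<le> (cmod (f x))\<^sup>2 + (cmod (g x))\<^sup>2" by linarith
    then show "norm (f x * cnj (g x)) \<le> norm ((cmod (f x))\<^sup>2 + (cmod (g x))\<^sup>2)"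
      by (simp add: norm_mult)
  qed
qed (use f g in \<open>auto dest!: L2_fun_measurable\<close>)

lemma L2_norm_on_power2: "(L2_norm_on N f)\<^sup>2 = (LINT x|N. (cmod (f x))\<^sup>2)"
  by (simp add: L2_norm_on_def)

text \<open>Totality only asks for some finite combination with arbitrary coefficients;
  \<open>pythagoras\<close> later shows that the Fourier coefficients do at least as well. The
  squared norm \<open>m\<close> is not normalised to 1 because for exponentials on the cell it is
  the volume of the cell.\<close>

locale orthogonal_basis =
  fixes N :: "'a measure" and J :: "'j set" and e :: "'j \<Rightarrow> 'a \<Rightarrow> complex" and m :: real
  assumes m_pos: "0 < m"
    and e_L2: "\<And>j. j \<in> J \<Longrightarrow> e j \<in> L2_fun N"
    and e_orthogonal: "\<And>j j'. j \<in> J \<Longrightarrow> j' \<in> J \<Longrightarrow>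
          L2_inner_on N (e j) (e j') = (if j = j' then of_real m else 0)"
    and e_total: "\<And>f \<epsilon>. f \<in> L2_fun N \<Longrightarrow> 0 < \<epsilon> \<Longrightarrow>
          \<exists>F c. finite F \<and> F \<subseteq> J \<and> (LINT x|N. (cmod (f x - (\<Sum>j\<in>F. c j * e j x)))\<^sup>2) < \<epsilon>"
begin

definition coef :: "('a \<Rightarrow> complex) \<Rightarrow> 'j \<Rightarrow> complex" where
  "coef f j = L2_inner_on N f (e j) / of_real m"

lemma coef_diff:
  assumes f: "f \<in> L2_fun N" and j: "j \<in> J" "j' \<in> J" "j \<noteq> j'"
  shows "coef (\<lambda>x. f x - c * e j x) j' = coef f j'"
proof -
  have "L2_inner_on N (\<lambda>x. f x - c * e j x) (e j') =
        (LINT x|N. f x * cnj (e j' x) - c * (e j x * cnj (e j' x)))"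
    by (simp add: L2_inner_on_def algebra_simps)
  also have "\<dots> = L2_inner_on N f (e j') - c * L2_inner_on N (e j) (e j')"
    unfolding L2_inner_on_def
    by (subst Bochner_Integration.integral_diff)
       (use f j in \<open>auto intro!: L2_fun_integrable_inner e_L2\<close>)
  finally show ?thesis using j by (simp add: coef_def e_orthogonal)
qed

text \<open>Expanding the square and completing it in \<open>c\<close> splits the error into a part
  independent of \<open>c\<close> and a penalty for missing the Fourier coefficient.\<close>

lemma pythagoras_single:
  assumes f: "f \<in> L2_fun N" and j: "j \<in> J"
  shows "(LINT x|N. (cmod (f x - c * e j x))\<^sup>2) =
         (LINT x|N. (cmod (f x))\<^sup>2) - m * (cmod (coef f j))\<^sup>2 + m * (cmod (c - coef f j))\<^sup>2"
proof -
  have pw: "(cmod (z - c * w))\<^sup>2 =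
      Re (z * cnj z) - 2 * Re (cnj c * (z * cnj w)) + (cmod c)\<^sup>2 * Re (w * cnj w)" for z w
    unfolding cmod_power2 by (simp add: algebra_simps power2_eq_square)
  define fe where "fe x = f x * cnj (e j x)" for x
  define ee where "ee x = e j x * cnj (e j x)" for x
  define ff where "ff x = f x * cnj (f x)" for x
  have i: "integrable N ff" "integrable N fe" "integrable N ee"
    unfolding ff_def fe_def ee_def
    by (auto intro!: L2_fun_integrable_inner f e_L2 j simp del: complex_mult_cnj)
  have i': "integrable N (\<lambda>x. Re (ff x))" "integrable N (\<lambda>x. Re (cnj c * fe x))"
    "integrable N (\<lambda>x. Re (ee x))"
    using i by auto
  have ff: "Re (ff x) = (cmod (f x))\<^sup>2" for x
    unfolding cmod_power2 by (simp add: ff_def power2_eq_square)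
  have "(LINT x|N. (cmod (f x - c * e j x))\<^sup>2) =
     (LINT x|N. Re (ff x) - 2 * Re (cnj c * fe x) + (cmod c)\<^sup>2 * Re (ee x))"
    unfolding pw ff_def fe_def ee_def ..
  also have "\<dots> = (LINT x|N. Re (ff x) - 2 * Re (cnj c * fe x)) + (LINT x|N. (cmod c)\<^sup>2 * Re (ee x))"
    by (intro Bochner_Integration.integral_add Bochner_Integration.integrable_diff integrable_mult_right i')
  also have "(LINT x|N. Re (ff x) - 2 * Re (cnj c * fe x)) =
      (LINT x|N. Re (ff x)) - (LINT x|N. 2 * Re (cnj c * fe x))"
    by (intro Bochner_Integration.integral_diff integrable_mult_right i')
  also have "(LINT x|N. 2 * Re (cnj c * fe x)) = 2 * Re (cnj c * L2_inner_on N f (e j))"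
  proof -
    have "(LINT x|N. Re (cnj c * fe x)) = Re (LINT x|N. cnj c * fe x)"
      using i by (intro integral_Re integrable_mult_right)
    then show ?thesis
      unfolding L2_inner_on_def fe_def[symmetric] by (simp del: times_complex.sel)
  qed
  also have "(LINT x|N. (cmod c)\<^sup>2 * Re (ee x)) = (cmod c)\<^sup>2 * Re (L2_inner_on N (e j) (e j))"
    unfolding L2_inner_on_def ee_def[symmetric] using i by (simp add: integral_Re)
  also have "(LINT x|N. Re (ff x)) = (LINT x|N. (cmod (f x))\<^sup>2)"
    unfolding ff ..
  also have "L2_inner_on N f (e j) = of_real m * coef f j"
    using m_pos by (simp add: coef_def)
  also have "L2_inner_on N (e j) (e j) = of_real m"
    using e_orthogonal[OF j j] by simp
  moreover have "m * (cmod (c - coef f j))\<^sup>2 =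
      (cmod c)\<^sup>2 * m - 2 * Re (cnj c * (of_real m * coef f j)) + m * (cmod (coef f j))\<^sup>2"
    unfolding cmod_power2 by (simp add: algebra_simps power2_eq_square)
  ultimately show ?thesis by simp
qed

text \<open>Terms are subtracted one at a time; by orthogonality (\<open>coef_diff\<close>) this
  leaves the Fourier coefficients at the remaining indices unchanged.\<close>

lemma pythagoras:
  assumes "finite F" "F \<subseteq> J" "f \<in> L2_fun N"
  shows "(LINT x|N. (cmod (f x - (\<Sum>j\<in>F. c j * e j x)))\<^sup>2) =
         (LINT x|N. (cmod (f x))\<^sup>2) - m * (\<Sum>j\<in>F. (cmod (coef f j))\<^sup>2)
           + m * (\<Sum>j\<in>F. (cmod (c j - coef f j))\<^sup>2)"
  using assms
proof (induction F arbitrary: f rule: finite_induct)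
  case (insert j F)
  define f' where "f' = (\<lambda>x. f x - c j * e j x)"
  have f': "f' \<in> L2_fun N"
    unfolding f'_def using insert.prems by (intro L2_fun_diff L2_fun_cmult e_L2) auto
  have co: "coef f' i = coef f i" if "i \<in> F" for i
    unfolding f'_def using insert that by (intro coef_diff) auto
  have "(LINT x|N. (cmod (f x - (\<Sum>i\<in>insert j F. c i * e i x)))\<^sup>2) =
        (LINT x|N. (cmod (f' x - (\<Sum>i\<in>F. c i * e i x)))\<^sup>2)"
    using insert.hyps by (simp add: f'_def algebra_simps)
  also have "\<dots> = (LINT x|N. (cmod (f' x))\<^sup>2) - m * (\<Sum>i\<in>F. (cmod (coef f i))\<^sup>2)
           + m * (\<Sum>i\<in>F. (cmod (c i - coef f i))\<^sup>2)"
    using insert.IH[OF _ f'] insert.prems by (simp add: co)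
  also have "(LINT x|N. (cmod (f' x))\<^sup>2) =
       (LINT x|N. (cmod (f x))\<^sup>2) - m * (cmod (coef f j))\<^sup>2 + m * (cmod (c j - coef f j))\<^sup>2"
    unfolding f'_def using insert.prems by (intro pythagoras_single) auto
  finally show ?case using insert.hyps by (simp add: algebra_simps)
qed simp

text \<open>Taking \<open>coef f\<close> as coefficients in \<open>pythagoras\<close> gives Bessel's
  inequality. Conversely the error of any approximation from \<open>e_total\<close> is at least the
  error with Fourier coefficients on the same set, so the partial sums come arbitrarily close to the
  bound.\<close>

lemma parseval:
  assumes f: "f \<in> L2_fun N"
  shows "((\<lambda>j. (cmod (coef f j))\<^sup>2) has_sum (LINT x|N. (cmod (f x))\<^sup>2) / m) J"
proof -
  define E where "E = (LINT x|N. (cmod (f x))\<^sup>2)"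
  define S where "S F = (\<Sum>j\<in>F. (cmod (coef f j))\<^sup>2)" for F
  have le: "m * S F \<le> E" if "finite F" "F \<subseteq> J" for F
  proof -
    have "0 \<le> (LINT x|N. (cmod (f x - (\<Sum>j\<in>F. coef f j * e j x)))\<^sup>2)" by simp
    also have "\<dots> = E - m * S F"
      unfolding E_def S_def using pythagoras[OF that f, of "coef f"] by simp
    finally show ?thesis by simp
  qed
  have "(S \<longlongrightarrow> E / m) (finite_subsets_at_top J)"
  proof (rule tendstoI)
    fix \<epsilon> :: real assume "0 < \<epsilon>"
    then have "0 < m * \<epsilon>" using m_pos by simp
    from e_total[OF f this] obtain F c where F: "finite F" "F \<subseteq> J"
      and lt: "(LINT x|N. (cmod (f x - (\<Sum>j\<in>F. c j * e j x)))\<^sup>2) < m * \<epsilon>" by blast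
    have "0 \<le> m * (\<Sum>j\<in>F. (cmod (c j - coef f j))\<^sup>2)"
      using m_pos by (simp add: sum_nonneg)
    then have FE: "E - m * S F < m * \<epsilon>"
      using lt pythagoras[OF F f, of c] unfolding E_def S_def by linarith
    show "\<forall>\<^sub>F G in finite_subsets_at_top J. dist (S G) (E / m) < \<epsilon>"
      unfolding eventually_finite_subsets_at_top
    proof (intro exI conjI allI impI)
      fix G assume G: "finite G \<and> F \<subseteq> G \<and> G \<subseteq> J"
      have "S F \<le> S G" unfolding S_def using G by (intro sum_mono2) auto
      then have "m * S F \<le> m * S G" using m_pos by simp
      then have "\<bar>m * S G - E\<bar> < m * \<epsilon>" using FE le[of G] G by auto
      then have "\<bar>m * (S G - E / m)\<bar> < m * \<epsilon>" using m_pos by (simp add: right_diff_distrib)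
      then show "dist (S G) (E / m) < \<epsilon>" using m_pos by (simp add: abs_mult dist_real_def)
    qed (use F in auto)
  qed
  then show ?thesis unfolding has_sum_def S_def E_def .
qed

end

text \<open>The expression multiplied by A and B is the exact error of \<open>pythagoras\<close>,
  and the hypothesis makes the true error comparable to it. It tends to 0 for c = d, while any
  deviation at one index keeps it away from 0, so \<open>d\<close> is the only expansion. The empty
  set F compares the norm of f with E, which yields the Riesz constants.\<close>

lemma riesz_basisI:
  fixes N :: "'a measure" and I :: "'i set"
  assumes I: "countable I" and h: "\<And>l. l \<in> I \<Longrightarrow> h l \<in> L2_fun N"
    and pos: "0 < m" "0 < A" "0 < B"
    and analysis: "\<And>f. f \<in> L2_fun N \<Longrightarrow> \<exists>E d. ((\<lambda>l. (cmod (d l))\<^sup>2) has_sum E / m) I \<and>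
      (\<forall>F c. finite F \<longrightarrow> F \<subseteq> I \<longrightarrow>
         A * (E - m * (\<Sum>l\<in>F. (cmod (d l))\<^sup>2) + m * (\<Sum>l\<in>F. (cmod (c l - d l))\<^sup>2))
           \<le> (LINT x|N. (cmod (f x - (\<Sum>l\<in>F. c l * h l x)))\<^sup>2) \<and>
         (LINT x|N. (cmod (f x - (\<Sum>l\<in>F. c l * h l x)))\<^sup>2)
           \<le> B * (E - m * (\<Sum>l\<in>F. (cmod (d l))\<^sup>2) + m * (\<Sum>l\<in>F. (cmod (c l - d l))\<^sup>2)))"
  shows "riesz_basis N I h"
proof -
  have main: "\<exists>d. l2_expansion N I h f d \<and> (\<forall>c. l2_expansion N I h f c \<longrightarrow> c = d) \<and>
      1 / (B * m) * (L2_norm_on N f)\<^sup>2 \<le> (\<Sum>\<^sub>\<infinity>l\<in>I. (cmod (d l))\<^sup>2) \<and>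
      (\<Sum>\<^sub>\<infinity>l\<in>I. (cmod (d l))\<^sup>2) \<le> 1 / (A * m) * (L2_norm_on N f)\<^sup>2"
    if f: "f \<in> L2_fun N" for f
  proof -
    define S where "S c F = (LINT x|N. (cmod (f x - (\<Sum>l\<in>F. c l * h l x)))\<^sup>2)" for c F
    from analysis[OF f] obtain E d where E: "((\<lambda>l. (cmod (d l))\<^sup>2) has_sum E / m) I"
      and S: "\<forall>F c. finite F \<longrightarrow> F \<subseteq> I \<longrightarrow>
         A * (E - m * (\<Sum>l\<in>F. (cmod (d l))\<^sup>2) + m * (\<Sum>l\<in>F. (cmod (c l - d l))\<^sup>2)) \<le> S c F \<and>
         S c F \<le> B * (E - m * (\<Sum>l\<in>F. (cmod (d l))\<^sup>2) + m * (\<Sum>l\<in>F. (cmod (c l - d l))\<^sup>2))"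
      unfolding S_def by (elim exE conjE)
    have lower: "A * (E - m * (\<Sum>l\<in>F. (cmod (d l))\<^sup>2) + m * (\<Sum>l\<in>F. (cmod (c l - d l))\<^sup>2)) \<le> S c F"
      and upper: "S c F \<le> B * (E - m * (\<Sum>l\<in>F. (cmod (d l))\<^sup>2) + m * (\<Sum>l\<in>F. (cmod (c l - d l))\<^sup>2))"
      if "finite F" "F \<subseteq> I" for F c
      using S[rule_format, OF that] by simp_all
    \<comment> \<open>\<open>l2_expansion\<close> requires coefficients that vanish off I, and
      \<open>d\<close> is arbitrary there.\<close>
    define d' where "d' l = (if l \<in> I then d l else 0)" for l
    have E': "((\<lambda>l. (cmod (d' l))\<^sup>2) has_sum E / m) I"
      using E has_sum_cong[of I "\<lambda>l. (cmod (d' l))\<^sup>2" "\<lambda>l. (cmod (d l))\<^sup>2"] by (simp add: d'_def)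
    have le: "m * (\<Sum>l\<in>F. (cmod (d l))\<^sup>2) \<le> E" if "finite F" "F \<subseteq> I" for F
    proof -
      have "(\<Sum>l\<in>F. (cmod (d l))\<^sup>2) \<le> E / m"
        using that by (intro has_sum_mono2[OF has_sum_finite E]) auto
      then show ?thesis using pos(1) by (simp add: field_simps)
    qed
    have fin: "\<forall>\<^sub>F F in finite_subsets_at_top I. finite F \<and> F \<subseteq> I"
      by (rule eventually_finite_subsets_at_top_weakI) auto
    have lim: "((\<lambda>F. B * (E - m * (\<Sum>l\<in>F. (cmod (d l))\<^sup>2))) \<longlongrightarrow> 0) (finite_subsets_at_top I)"
    proof -
      have "((\<lambda>F. B * (E - m * (\<Sum>l\<in>F. (cmod (d l))\<^sup>2))) \<longlongrightarrow> B * (E - m * (E / m)))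
              (finite_subsets_at_top I)"
        using E unfolding has_sum_def by (intro tendsto_intros)
      then show ?thesis using pos(1) by simp
    qed
    have "(S d' \<longlongrightarrow> 0) (finite_subsets_at_top I)"
    proof (rule tendsto_sandwich[OF _ _ tendsto_const lim])
      show "\<forall>\<^sub>F F in finite_subsets_at_top I. S d' F \<le> B * (E - m * (\<Sum>l\<in>F. (cmod (d l))\<^sup>2))"
        using fin
      proof eventually_elim
        case (elim F)
        then have "(\<Sum>l\<in>F. (cmod (d' l - d l))\<^sup>2) = 0"
          by (intro sum.neutral) (auto simp: d'_def)
        then show ?case using upper[of F d'] elim by simp
      qed
    qed (simp add: S_def)
    then have "((\<lambda>F. sqrt (S d' F)) \<longlongrightarrow> sqrt 0) (finite_subsets_at_top I)"
      by (intro tendsto_intros)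
    then have ex: "l2_expansion N I h f d'"
      using E' unfolding l2_expansion_def S_def
      by (auto simp: L2_norm_on_def d'_def summable_on_def)
    have uniq: "c = d'" if c: "l2_expansion N I h f c" for c
    proof
      fix l
      have c0: "((\<lambda>F. (L2_norm_on N (\<lambda>x. f x - (\<Sum>l\<in>F. c l * h l x)))\<^sup>2) \<longlongrightarrow> 0\<^sup>2)
            (finite_subsets_at_top I)"
        using c unfolding l2_expansion_def by (intro tendsto_intros) auto
      then have c0: "(S c \<longlongrightarrow> 0) (finite_subsets_at_top I)"
        by (simp add: L2_norm_on_power2 S_def[abs_def])
      show "c l = d' l"
      proof (cases "l \<in> I")
        case True
        \<comment> \<open>Once F contains l, the deviation at l alone bounds the error from below,
          and the error tends to 0.\<close>
        have "A * m * (cmod (c l - d l))\<^sup>2 \<le> 0"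
        proof (rule tendsto_lowerbound[OF c0])
          show "\<forall>\<^sub>F F in finite_subsets_at_top I. A * m * (cmod (c l - d l))\<^sup>2 \<le> S c F"
            unfolding eventually_finite_subsets_at_top
          proof (intro exI conjI allI impI)
            fix F assume F: "finite F \<and> {l} \<subseteq> F \<and> F \<subseteq> I"
            have "(cmod (c l - d l))\<^sup>2 \<le> (\<Sum>l\<in>F. (cmod (c l - d l))\<^sup>2)"
              using F by (intro member_le_sum) auto
            then have "m * (cmod (c l - d l))\<^sup>2 \<le> m * (\<Sum>l\<in>F. (cmod (c l - d l))\<^sup>2)"
              using pos by simp
            then have "m * (cmod (c l - d l))\<^sup>2 \<le>
               E - m * (\<Sum>l\<in>F. (cmod (d l))\<^sup>2) + m * (\<Sum>l\<in>F. (cmod (c l - d l))\<^sup>2)"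
              using le[of F] F by linarith
            then have "A * (m * (cmod (c l - d l))\<^sup>2) \<le>
               A * (E - m * (\<Sum>l\<in>F. (cmod (d l))\<^sup>2) + m * (\<Sum>l\<in>F. (cmod (c l - d l))\<^sup>2))"
              using pos by (intro mult_left_mono) auto
            then show "A * m * (cmod (c l - d l))\<^sup>2 \<le> S c F"
              using lower[of F c] F by (simp add: mult.assoc)
          qed (use True in auto)
        qed simp
        moreover have "0 < A * m" using pos by simp
        ultimately have "(cmod (c l - d l))\<^sup>2 \<le> 0"
          using mult_pos_pos[of "A * m" "(cmod (c l - d l))\<^sup>2"] by linarith
        then show ?thesis using True by (simp add: d'_def)
      next
        case False
        then show ?thesis using c by (simp add: l2_expansion_def d'_def)
      qed
    qed
    have "A * E \<le> (L2_norm_on N f)\<^sup>2" "(L2_norm_on N f)\<^sup>2 \<le> B * E"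
      using lower[of "{}" d] upper[of "{}" d] by (simp_all add: L2_norm_on_power2 S_def)
    moreover have "(\<Sum>\<^sub>\<infinity>l\<in>I. (cmod (d' l))\<^sup>2) = E / m"
      using E' by (rule infsumI)
    ultimately have "1 / (B * m) * (L2_norm_on N f)\<^sup>2 \<le> (\<Sum>\<^sub>\<infinity>l\<in>I. (cmod (d' l))\<^sup>2)"
      "(\<Sum>\<^sub>\<infinity>l\<in>I. (cmod (d' l))\<^sup>2) \<le> 1 / (A * m) * (L2_norm_on N f)\<^sup>2"
      using pos by (simp_all add: field_simps)
    then show ?thesis using ex uniq by blast
  qed
  \<comment> \<open>\<open>riesz_basis\<close> wants its lower constant to be at most its upper one,
    and A and B are not compared in the hypotheses; hence the maximum.\<close>
  have AB: "1 / (A * m) * x \<le> max (1 / (A * m)) (1 / (B * m)) * x" if "0 \<le> x" for x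
    using that by (intro mult_right_mono) auto
  have "1 / (B * m) * (L2_norm_on N f)\<^sup>2 \<le> (\<Sum>\<^sub>\<infinity>l\<in>I. (cmod (c l))\<^sup>2) \<and>
      (\<Sum>\<^sub>\<infinity>l\<in>I. (cmod (c l))\<^sup>2) \<le> max (1 / (A * m)) (1 / (B * m)) * (L2_norm_on N f)\<^sup>2"
    if "f \<in> L2_fun N" and c: "l2_expansion N I h f c" for f c
    using main[OF that(1)] c AB[of "(L2_norm_on N f)\<^sup>2"] by fastforce
  moreover have "0 < 1 / (B * m)" "1 / (B * m) \<le> max (1 / (A * m)) (1 / (B * m))"
    using pos by auto
  moreover have "\<exists>!c. l2_expansion N I h f c" if "f \<in> L2_fun N" for f
    using main[OF that] by blast
  ultimately show ?thesis
    unfolding riesz_basis_def using I h by blast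
qed

section \<open>Bases from matrix functions\<close>

lemma has_sum_UN_disjoint_finite:
  fixes f :: "'a \<Rightarrow> 'b::{topological_comm_monoid_add}"
  assumes "finite S" "\<And>s. s \<in> S \<Longrightarrow> (f has_sum a s) (A s)"
    "\<And>s t. s \<in> S \<Longrightarrow> t \<in> S \<Longrightarrow> s \<noteq> t \<Longrightarrow> A s \<inter> A t = {}"
  shows "(f has_sum (\<Sum>s\<in>S. a s)) (\<Union>s\<in>S. A s)"
  using assms
proof (induction S rule: finite_induct)
  case (insert s S)
  have "(f has_sum (a s + (\<Sum>s\<in>S. a s))) (A s \<union> (\<Union>s\<in>S. A s))"
    using insert by (intro has_sum_Un_disjoint) auto
  then show ?case using insert.hyps by simp
qed simp

text \<open>Injectivity makes G the disjoint union over s of its fibres, so a sum over frequencies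
  turns into sums over the k components of the model space.\<close>

lemma sum_fibres:
  fixes \<iota> :: "'j \<Rightarrow> 'k::finite \<Rightarrow> 'i" and \<phi> :: "'i \<Rightarrow> 'b::comm_monoid_add"
  assumes inj: "\<And>j s j' s'. j \<in> J \<Longrightarrow> j' \<in> J \<Longrightarrow> \<iota> j s = \<iota> j' s' \<Longrightarrow> j = j' \<and> s = s'"
    and G: "finite G" "G \<subseteq> (\<Union>s. (\<lambda>j. \<iota> j s) ` J)"
  shows "finite {j \<in> J. \<iota> j s \<in> G}"
    and "(\<Sum>l\<in>G. \<phi> l) = (\<Sum>s\<in>UNIV. \<Sum>j\<in>{j \<in> J. \<iota> j s \<in> G}. \<phi> (\<iota> j s))"
proof -
  show fin: "finite {j \<in> J. \<iota> j s \<in> G}" for s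
  proof (rule inj_on_finite[of "\<lambda>j. \<iota> j s"])
    show "inj_on (\<lambda>j. \<iota> j s) {j \<in> J. \<iota> j s \<in> G}"
      by (rule inj_onI) (use inj in blast)
  qed (use G in auto)
  have bij: "bij_betw (\<lambda>(s, j). \<iota> j s) (Sigma UNIV (\<lambda>s. {j \<in> J. \<iota> j s \<in> G})) G"
    unfolding bij_betw_def
  proof
    show "inj_on (\<lambda>(s, j). \<iota> j s) (Sigma UNIV (\<lambda>s. {j \<in> J. \<iota> j s \<in> G}))"
      by (rule inj_onI) (use inj in \<open>auto split: prod.splits\<close>)
    show "(\<lambda>(s, j). \<iota> j s) ` Sigma UNIV (\<lambda>s. {j \<in> J. \<iota> j s \<in> G}) = G"
      using G(2) by (force simp: image_iff)
  qed
  have "(\<Sum>s\<in>UNIV. \<Sum>j\<in>{j \<in> J. \<iota> j s \<in> G}. \<phi> (\<iota> j s)) =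
        (\<Sum>(s, j)\<in>Sigma UNIV (\<lambda>s. {j \<in> J. \<iota> j s \<in> G}). \<phi> (\<iota> j s))"
    using fin by (intro sum.Sigma) auto
  also have "\<dots> = (\<Sum>l\<in>G. \<phi> l)"
    using sum.reindex_bij_betw[OF bij, of \<phi>] by (simp add: case_prod_unfold)
  finally show "(\<Sum>l\<in>G. \<phi> l) = (\<Sum>s\<in>UNIV. \<Sum>j\<in>{j \<in> J. \<iota> j s \<in> G}. \<phi> (\<iota> j s))" ..
qed

text \<open>Cauchy-Schwarz in every row. The bound is crude, but it depends only on the size of the
  entries, so it is uniform in the point at which a matrix function is evaluated.\<close>

lemma sum_cmod_matrix_vector_le:
  fixes A :: "complex^'n::finite^'m::finite"
  assumes "\<And>r s. cmod (A $ r $ s) \<le> K"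
  shows "(\<Sum>r\<in>UNIV. (cmod ((A *v z) $ r))\<^sup>2) \<le>
         (real CARD('m) * real CARD('n) * K\<^sup>2) * (\<Sum>s\<in>UNIV. (cmod (z $ s))\<^sup>2)"
proof -
  have "(cmod ((A *v z) $ r))\<^sup>2 \<le> (real CARD('n) * K\<^sup>2) * (\<Sum>s\<in>UNIV. (cmod (z $ s))\<^sup>2)" for r
  proof -
    have "cmod ((A *v z) $ r) \<le> (\<Sum>s\<in>UNIV. K * cmod (z $ s))"
      unfolding matrix_vector_mult_def
      by (auto intro!: sum_norm_le simp: norm_mult mult_right_mono assms)
    then have "(cmod ((A *v z) $ r))\<^sup>2 \<le> (\<Sum>s\<in>UNIV. K * cmod (z $ s))\<^sup>2"
      by (intro power_mono) auto
    also have "\<dots> \<le> real CARD('n) * (\<Sum>s\<in>UNIV. (K * cmod (z $ s))\<^sup>2)"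
      using sum_squared_le_sum_of_squares[of "\<lambda>s. K * cmod (z $ s)" UNIV] by (simp add: mult.commute)
    finally show ?thesis by (simp add: power_mult_distrib sum_distrib_left mult.assoc)
  qed
  then have "(\<Sum>r\<in>(UNIV::'m set). (cmod ((A *v z) $ r))\<^sup>2) \<le>
     (\<Sum>r\<in>(UNIV::'m set). (real CARD('n) * K\<^sup>2) * (\<Sum>s\<in>UNIV. (cmod (z $ s))\<^sup>2))"
    by (intro sum_mono)
  then show ?thesis by (simp add: mult.assoc)
qed

lemma integral_sum_cmod_matrix_vector_le:
  fixes A :: "'a \<Rightarrow> complex^'n::finite^'m::finite"
  assumes u: "\<And>r. u r \<in> L2_fun P" and z: "\<And>s. z s \<in> L2_fun P"
    and A: "AE y in P. \<forall>r s. cmod (A y $ r $ s) \<le> K"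
    and uz: "AE y in P. \<forall>r. u r y = (\<Sum>s\<in>UNIV. A y $ r $ s * z s y)"
  shows "(\<Sum>r\<in>UNIV. LINT y|P. (cmod (u r y))\<^sup>2) \<le>
         (real CARD('m) * real CARD('n) * K\<^sup>2) * (\<Sum>s\<in>UNIV. LINT y|P. (cmod (z s y))\<^sup>2)"
proof -
  have "(\<Sum>r\<in>UNIV. LINT y|P. (cmod (u r y))\<^sup>2) = (LINT y|P. (\<Sum>r\<in>UNIV. (cmod (u r y))\<^sup>2))"
    by (subst Bochner_Integration.integral_sum) (auto intro!: L2_fun_integrable u)
  also have "\<dots> \<le> (LINT y|P. (real CARD('m) * real CARD('n) * K\<^sup>2) * (\<Sum>s\<in>UNIV. (cmod (z s y))\<^sup>2))"
  proof (rule integral_mono_AE)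
    show "AE y in P. (\<Sum>r\<in>UNIV. (cmod (u r y))\<^sup>2) \<le>
        (real CARD('m) * real CARD('n) * K\<^sup>2) * (\<Sum>s\<in>UNIV. (cmod (z s y))\<^sup>2)"
      using A uz
    proof eventually_elim
      case (elim y)
      have "u r y = (A y *v (\<chi> s. z s y)) $ r" for r
        using elim(2) by (simp add: matrix_vector_mult_def)
      then show ?case using sum_cmod_matrix_vector_le[of "A y" K "\<chi> s. z s y"] elim(1) by simp
    qed
  qed (auto intro!: L2_fun_integrable u z)
  also have "\<dots> = (real CARD('m) * real CARD('n) * K\<^sup>2) * (\<Sum>s\<in>UNIV. LINT y|P. (cmod (z s y))\<^sup>2)"
    by (simp, subst Bochner_Integration.integral_sum) (auto intro!: L2_fun_integrable z)
  finally show ?thesis .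
qed

text \<open>\<open>unfold_N\<close> says that N consists of k sheets, each parametrised by P. The
  error \<open>u\<close> on the sheets and the error \<open>z\<close> in the model satisfy u = W z
  and z = U u pointwise, so each controls the other by the same factor, and
  \<open>pythagoras\<close> computes \<open>z\<close> exactly, component by component.\<close>

lemma riesz_basis_fibres:
  fixes N :: "'a measure" and P :: "'b measure" and \<omega> :: "'k::finite \<Rightarrow> 'b \<Rightarrow> 'a"
    and \<iota> :: "'j \<Rightarrow> 'k \<Rightarrow> 'i" and W U :: "'b \<Rightarrow> complex^'k^'k"
  assumes basis: "orthogonal_basis P J e m"
    and J: "countable J"
    and I: "I = (\<Union>s. (\<lambda>j. \<iota> j s) ` J)"
    and inj: "\<And>j s j' s'. j \<in> J \<Longrightarrow> j' \<in> J \<Longrightarrow> \<iota> j s = \<iota> j' s' \<Longrightarrow> j = j' \<and> s = s'"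
    and \<omega>: "\<And>r. \<omega> r \<in> measurable P N"
    and unfold_N: "\<And>f::'a \<Rightarrow> real. integrable N f \<Longrightarrow>
          (\<forall>r. integrable P (\<lambda>y. f (\<omega> r y))) \<and> (LINT x|N. f x) = (\<Sum>r\<in>UNIV. LINT y|P. f (\<omega> r y))"
    and h: "\<And>l. l \<in> I \<Longrightarrow> h l \<in> L2_fun N"
    and hW: "\<And>j s r. j \<in> J \<Longrightarrow> AE y in P. h (\<iota> j s) (\<omega> r y) = W y $ r $ s * e j y"
    and U: "\<And>r s. (\<lambda>y. U y $ r $ s) \<in> borel_measurable P"
    and bounded: "AE y in P. \<forall>r s. cmod (W y $ r $ s) \<le> K" "AE y in P. \<forall>r s. cmod (U y $ r $ s) \<le> K"
    and inverse: "AE y in P. W y ** U y = mat 1 \<and> U y ** W y = mat 1"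
    and K: "0 < K"
  shows "riesz_basis N I h"
proof -
  interpret orthogonal_basis P J e m by fact
  define B where "B = real CARD('k) * real CARD('k) * K\<^sup>2"
  have B: "0 < B" using K by (simp add: B_def)
  have comp: "(\<lambda>y. f (\<omega> r y)) \<in> L2_fun P" if "f \<in> L2_fun N" for f :: "'a \<Rightarrow> complex" and r
  proof -
    have "(\<lambda>y. f (\<omega> r y)) \<in> borel_measurable P"
      using measurable_compose[OF \<omega> L2_fun_measurable[OF that]] .
    then show ?thesis
      using unfold_N[OF L2_fun_integrable[OF that]] by (simp add: L2_fun_def)
  qed
  have disj: "(\<lambda>j. \<iota> j s) ` J \<inter> (\<lambda>j. \<iota> j t) ` J = {}" if "s \<noteq> t" for s t
    using inj that by fastforce
  show ?thesis
  proof (rule riesz_basisI[where m = m and A = "1 / B" and B = B])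
    show "countable I" using J by (simp add: I)
  next
    fix f assume f: "f \<in> L2_fun N"
    \<comment> \<open>U undoes W, so these are the components that have to be expanded in the
      orthogonal basis.\<close>
    define C where "C s y = (\<Sum>r\<in>UNIV. U y $ s $ r * f (\<omega> r y))" for s y
    have C: "C s \<in> L2_fun P" for s
      unfolding C_def using bounded(2)
      by (intro L2_fun_sum L2_fun_bounded_times[where K = K] comp f U) auto
    define E where "E = (\<Sum>s\<in>UNIV. LINT y|P. (cmod (C s y))\<^sup>2)"
    \<comment> \<open>A definite description is legitimate on I because a frequency determines its
      pair (j, s).\<close>
    define d where "d l = (THE z. \<exists>j s. j \<in> J \<and> l = \<iota> j s \<and> z = coef (C s) j)" for l
    have d: "d (\<iota> j s) = coef (C s) j" if "j \<in> J" for j s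
      unfolding d_def using that inj by (intro the_equality) blast+
    have sum_d: "((\<lambda>l. (cmod (d l))\<^sup>2) has_sum E / m) I"
    proof -
      have "((\<lambda>l. (cmod (d l))\<^sup>2) has_sum (LINT y|P. (cmod (C s y))\<^sup>2) / m) ((\<lambda>j. \<iota> j s) ` J)" for s
      proof -
        have "inj_on (\<lambda>j. \<iota> j s) J" by (rule inj_onI) (use inj in blast)
        moreover have "(((\<lambda>l. (cmod (d l))\<^sup>2) \<circ> (\<lambda>j. \<iota> j s)) has_sum (LINT y|P. (cmod (C s y))\<^sup>2) / m) J"
          using parseval[OF C, of s] by (subst has_sum_cong) (auto simp: d)
        ultimately show ?thesis by (simp add: has_sum_reindex)
      qed
      then have "((\<lambda>l. (cmod (d l))\<^sup>2) has_sum (\<Sum>s\<in>UNIV. (LINT y|P. (cmod (C s y))\<^sup>2) / m)) I"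
        unfolding I using disj by (intro has_sum_UN_disjoint_finite) auto
      then show ?thesis by (simp add: E_def sum_divide_distrib)
    qed
    have bounds: "1 / B * (E - m * (\<Sum>l\<in>G. (cmod (d l))\<^sup>2) + m * (\<Sum>l\<in>G. (cmod (c l - d l))\<^sup>2))
           \<le> (LINT x|N. (cmod (f x - (\<Sum>l\<in>G. c l * h l x)))\<^sup>2) \<and>
         (LINT x|N. (cmod (f x - (\<Sum>l\<in>G. c l * h l x)))\<^sup>2)
           \<le> B * (E - m * (\<Sum>l\<in>G. (cmod (d l))\<^sup>2) + m * (\<Sum>l\<in>G. (cmod (c l - d l))\<^sup>2))"
      if G: "finite G" "G \<subseteq> I" for G c
    proof -
      define Gs where "Gs s = {j \<in> J. \<iota> j s \<in> G}" for s
      have Gs: "finite (Gs s)" "Gs s \<subseteq> J" for s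
        unfolding Gs_def using sum_fibres(1)[of J \<iota>] inj G unfolding I by auto
      have split: "(\<Sum>l\<in>G. \<phi> l) = (\<Sum>s\<in>UNIV. \<Sum>j\<in>Gs s. \<phi> (\<iota> j s))"
        for \<phi> :: "'i \<Rightarrow> 'z::comm_monoid_add"
        unfolding Gs_def using sum_fibres(2)[of J \<iota>] inj G unfolding I by auto
      define u where "u r y = f (\<omega> r y) - (\<Sum>l\<in>G. c l * h l (\<omega> r y))" for r y
      define z where "z s y = C s y - (\<Sum>j\<in>Gs s. c (\<iota> j s) * e j y)" for s y
      have res: "(\<lambda>x. f x - (\<Sum>l\<in>G. c l * h l x)) \<in> L2_fun N"
        using G by (intro L2_fun_diff L2_fun_sum L2_fun_cmult f h) auto
      have u: "u r \<in> L2_fun P" for r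
        using comp[OF res] by (simp add: u_def[abs_def])
      have z: "z s \<in> L2_fun P" for s
        unfolding z_def using Gs by (intro L2_fun_diff L2_fun_sum L2_fun_cmult C e_L2) auto
      have hW': "AE y in P. \<forall>r s. \<forall>j\<in>Gs s. h (\<iota> j s) (\<omega> r y) = W y $ r $ s * e j y"
        using hW Gs by (simp add: AE_all_countable AE_ball_countable countable_finite subset_iff)
      have uz: "AE y in P. \<forall>r. u r y = (\<Sum>s\<in>UNIV. W y $ r $ s * z s y)"
        using hW' inverse
      proof eventually_elim
        case (elim y)
        have C_W: "(\<Sum>s\<in>UNIV. W y $ r $ s * C s y) = f (\<omega> r y)" for r
        proof -
          have "(\<chi> s. C s y) = U y *v (\<chi> r. f (\<omega> r y))"
            by (simp add: vec_eq_iff matrix_vector_mult_def C_def)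
          then have "W y *v (\<chi> s. C s y) = (\<chi> r. f (\<omega> r y))"
            using elim by (simp add: matrix_vector_mul_assoc)
          then show ?thesis by (simp add: vec_eq_iff matrix_vector_mult_def)
        qed
        show ?case
        proof
          fix r
          have "(\<Sum>l\<in>G. c l * h l (\<omega> r y)) =
                (\<Sum>s\<in>UNIV. \<Sum>j\<in>Gs s. c (\<iota> j s) * (W y $ r $ s * e j y))"
            unfolding split using elim(1) by (intro sum.cong refl) auto
          also have "\<dots> = (\<Sum>s\<in>UNIV. W y $ r $ s * (\<Sum>j\<in>Gs s. c (\<iota> j s) * e j y))"
            by (simp add: sum_distrib_left mult.left_commute)
          finally show "u r y = (\<Sum>s\<in>UNIV. W y $ r $ s * z s y)"
            by (simp add: u_def z_def C_W right_diff_distrib sum_subtractf)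
        qed
      qed
      have zu: "AE y in P. \<forall>s. z s y = (\<Sum>r\<in>UNIV. U y $ s $ r * u r y)"
        using uz inverse
      proof eventually_elim
        case (elim y)
        have "(\<chi> r. u r y) = W y *v (\<chi> s. z s y)"
          using elim(1) by (simp add: vec_eq_iff matrix_vector_mult_def)
        then have "U y *v (\<chi> r. u r y) = (\<chi> s. z s y)"
          using elim(2) by (simp add: matrix_vector_mul_assoc)
        then show ?case by (simp add: vec_eq_iff matrix_vector_mult_def)
      qed
      have N: "(LINT x|N. (cmod (f x - (\<Sum>l\<in>G. c l * h l x)))\<^sup>2) = (\<Sum>r\<in>UNIV. LINT y|P. (cmod (u r y))\<^sup>2)"
        using unfold_N[OF L2_fun_integrable[OF res]] by (simp add: u_def)
      have P: "(\<Sum>s\<in>UNIV. LINT y|P. (cmod (z s y))\<^sup>2) =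
          E - m * (\<Sum>l\<in>G. (cmod (d l))\<^sup>2) + m * (\<Sum>l\<in>G. (cmod (c l - d l))\<^sup>2)"
      proof -
        have "(LINT y|P. (cmod (z s y))\<^sup>2) = (LINT y|P. (cmod (C s y))\<^sup>2)
            - m * (\<Sum>j\<in>Gs s. (cmod (d (\<iota> j s)))\<^sup>2) + m * (\<Sum>j\<in>Gs s. (cmod (c (\<iota> j s) - d (\<iota> j s)))\<^sup>2)" for s
          unfolding z_def pythagoras[OF Gs C] using Gs by (auto simp: d subset_iff)
        then show ?thesis
          by (simp add: split E_def sum.distrib sum_subtractf sum_distrib_left)
      qed
      have "(\<Sum>r\<in>UNIV. LINT y|P. (cmod (u r y))\<^sup>2) \<le> B * (\<Sum>s\<in>UNIV. LINT y|P. (cmod (z s y))\<^sup>2)"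
        unfolding B_def by (rule integral_sum_cmod_matrix_vector_le[OF u z bounded(1) uz])
      moreover have "(\<Sum>s\<in>UNIV. LINT y|P. (cmod (z s y))\<^sup>2) \<le> B * (\<Sum>r\<in>UNIV. LINT y|P. (cmod (u r y))\<^sup>2)"
        unfolding B_def by (rule integral_sum_cmod_matrix_vector_le[OF z u bounded(2) zu])
      ultimately show ?thesis unfolding N P using B by (simp add: field_simps)
    qed
    show "\<exists>E d. ((\<lambda>l. (cmod (d l))\<^sup>2) has_sum E / m) I \<and>
      (\<forall>F c. finite F \<longrightarrow> F \<subseteq> I \<longrightarrow>
         1 / B * (E - m * (\<Sum>l\<in>F. (cmod (d l))\<^sup>2) + m * (\<Sum>l\<in>F. (cmod (c l - d l))\<^sup>2))
           \<le> (LINT x|N. (cmod (f x - (\<Sum>l\<in>F. c l * h l x)))\<^sup>2) \<and>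
         (LINT x|N. (cmod (f x - (\<Sum>l\<in>F. c l * h l x)))\<^sup>2)
           \<le> B * (E - m * (\<Sum>l\<in>F. (cmod (d l))\<^sup>2) + m * (\<Sum>l\<in>F. (cmod (c l - d l))\<^sup>2)))"
      using sum_d bounds by blast
  qed (use B h m_pos in auto)
qed

section \<open>The least singular value\<close>

text \<open>The product \<bullet> is the real part of the Hermitian product, and the adjoint for it
  is still the conjugate transpose. This lets the variational argument below run over the
  reals.\<close>

lemma inner_conj_transpose:
  fixes A :: "complex^'n::finite^'n" and x y :: "complex^'n"
  shows "(A *v x) \<bullet> y = x \<bullet> (conj_transpose A *v y)"
proof -
  have "(A *v x) \<bullet> y = (\<Sum>i\<in>UNIV. \<Sum>j\<in>UNIV. (A $ i $ j * x $ j) \<bullet> (y $ i))"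
    by (simp add: inner_vec_def matrix_vector_mult_def inner_sum_left)
  also have "\<dots> = (\<Sum>i\<in>UNIV. \<Sum>j\<in>UNIV. (x $ j) \<bullet> (cnj (A $ i $ j) * y $ i))"
    by (simp add: inner_complex_def algebra_simps)
  also have "\<dots> = (\<Sum>j\<in>UNIV. \<Sum>i\<in>UNIV. (x $ j) \<bullet> (cnj (A $ i $ j) * y $ i))"
    by (rule sum.swap)
  also have "\<dots> = x \<bullet> (conj_transpose A *v y)"
    by (simp add: inner_vec_def matrix_vector_mult_def inner_sum_right conj_transpose_def
        map_matrix_def transpose_def)
  finally show ?thesis .
qed

lemma scaleR_vec_complex: "c *\<^sub>R x = complex_of_real c *s x" for x :: "complex^'n"
  unfolding vec_eq_iff vector_scaleR_component vector_smult_component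
  by (simp add: scaleR_conv_of_real)

text \<open>A minimiser of the Rayleigh quotient is an eigenvector of \<open>A\<^sup>* A\<close>, so the minimum is attained
  at a singular value.\<close>
lemma norm_matrix_vector_ge_singular_value:
  fixes A :: "complex^'n::finite^'n"
  obtains \<sigma> where "\<sigma> \<in> singular_values A" "\<And>x. \<sigma> * norm x \<le> norm (A *v x)"
proof -
  have lin: "linear ((*v) A)"
    by (simp add: linear_iff matrix_vector_right_distrib scaleR_vec_complex vector_scalar_commute)
  have "continuous_on (sphere 0 1) (\<lambda>x. norm (A *v x))"
    using lin by (intro continuous_on_norm linear_continuous_on linear_conv_bounded_linear[THEN iffD1])
  moreover have "sphere (0::complex^'n) 1 \<noteq> {}" by simp
  ultimately obtain v where v: "norm v = 1" and vmin: "\<And>x. norm x = 1 \<Longrightarrow> norm (A *v v) \<le> norm (A *v x)"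
    using continuous_attains_inf[of "sphere 0 1" "\<lambda>x. norm (A *v x)"] by auto
  define \<sigma> where "\<sigma> = norm (A *v v)"
  have ge: "\<sigma> * norm x \<le> norm (A *v x)" for x
  proof (cases "x = 0")
    case False
    have "\<sigma> \<le> norm (A *v ((1 / norm x) *\<^sub>R x))"
      unfolding \<sigma>_def using False by (intro vmin) simp
    also have "A *v ((1 / norm x) *\<^sub>R x) = (1 / norm x) *\<^sub>R (A *v x)"
      using lin by (simp add: linear_cmul)
    finally show ?thesis using False by (simp add: field_simps)
  qed simp
  \<comment> \<open>Half the derivative at v, in direction w, of the form |A x|^2 - \<sigma>^2
    |x|^2, which is nonnegative and vanishes at v.\<close>
  define b where "b w = (A *v v) \<bullet> (A *v w) - \<sigma>\<^sup>2 * (v \<bullet> w)" for w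
  have Q: "0 \<le> (A *v x) \<bullet> (A *v x) - \<sigma>\<^sup>2 * (x \<bullet> x)" for x
  proof -
    have "(\<sigma> * norm x)\<^sup>2 \<le> (norm (A *v x))\<^sup>2"
      using ge by (intro power_mono) (auto simp: \<sigma>_def)
    then show ?thesis by (simp add: power_mult_distrib power2_norm_eq_inner)
  qed
  have Qv: "(A *v v) \<bullet> (A *v v) = \<sigma>\<^sup>2" "v \<bullet> v = 1"
    using v by (simp_all add: \<sigma>_def power2_norm_eq_inner norm_eq_1)
  have b0: "b w = 0" for w
  proof -
    define q where "q = (A *v w) \<bullet> (A *v w) - \<sigma>\<^sup>2 * (w \<bullet> w)"
    have t: "0 \<le> 2 * t * b w + t\<^sup>2 * q" for t :: real
      using Q[of "v + t *\<^sub>R w"] lin Qv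
      by (simp add: linear_add linear_cmul inner_add_left inner_add_right b_def q_def inner_commute
          power2_eq_square algebra_simps)
    have "q \<ge> 0" using Q by (simp add: q_def)
    \<comment> \<open>The quadratic in t would be minimal at t = - b w / q, but q may be 0. With q +
      1 the value is still - (b w)^2 (q + 2) / (q + 1)^2, which is negative unless b w = 0.\<close>
    have "0 \<le> 2 * (- b w / (q + 1)) * b w + (- b w / (q + 1))\<^sup>2 * q" by (rule t)
    also have "\<dots> = (b w)\<^sup>2 * (- 2 * (q + 1) + q) / (q + 1)\<^sup>2"
      using \<open>q \<ge> 0\<close> by (simp add: power2_eq_square divide_simps) (simp add: algebra_simps)
    finally have "0 \<le> (b w)\<^sup>2 * (- 2 * (q + 1) + q)"
      using \<open>q \<ge> 0\<close> by (simp add: zero_le_divide_iff)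
    then show ?thesis using \<open>q \<ge> 0\<close> by (auto simp: zero_le_mult_iff)
  qed
  \<comment> \<open>This is only the vanishing of a real part, but it holds for every w, so the
    vector itself is zero.\<close>
  have "(conj_transpose A *v (A *v v) - \<sigma>\<^sup>2 *\<^sub>R v) \<bullet> w = 0" for w
  proof -
    have "(conj_transpose A *v (A *v v)) \<bullet> w = (A *v v) \<bullet> (A *v w)"
      using inner_conj_transpose[of A w "A *v v"] by (simp add: inner_commute)
    then show ?thesis using b0[of w] by (simp add: b_def inner_diff_left)
  qed
  then have "conj_transpose A *v (A *v v) - \<sigma>\<^sup>2 *\<^sub>R v = 0"
    by (metis inner_eq_zero_iff)
  then have "(conj_transpose A ** A) *v v = of_real (\<sigma>\<^sup>2) *s v"
    by (simp add: matrix_vector_mul_assoc scaleR_vec_complex)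
  moreover have "v \<noteq> 0" "0 \<le> \<sigma>" using v by (auto simp: \<sigma>_def)
  ultimately have "\<sigma> \<in> singular_values A" unfolding singular_values_def by blast
  then show thesis using ge that by blast
qed

lemma matrix_vector_mult_axis: "(A *v axis s 1) $ r = A $ r $ s"
  for A :: "'a::semiring_1^'n::finite^'m"
  by (simp add: matrix_vector_mult_def axis_def if_distrib cong: if_cong)

text \<open>By the previous lemma A expands every vector at least by the factor \<alpha>. Hence A is
  injective, and the columns of its inverse, being preimages of unit vectors, have norm at most 1 /
  \<alpha>.\<close>

lemma matrix_inv_singular_values:
  fixes A :: "complex^'n::finite^'n"
  assumes "0 < \<alpha>" "\<And>\<sigma>. \<sigma> \<in> singular_values A \<Longrightarrow> \<alpha> < \<sigma>"
  shows "A ** matrix_inv A = mat 1" "matrix_inv A ** A = mat 1"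
    "cmod (matrix_inv A $ r $ s) \<le> 1 / \<alpha>"
proof -
  obtain \<sigma> where \<sigma>: "\<sigma> \<in> singular_values A" "\<And>x. \<sigma> * norm x \<le> norm (A *v x)"
    by (rule norm_matrix_vector_ge_singular_value[of A]) blast
  have ge: "\<alpha> * norm x \<le> norm (A *v x)" for x
    using \<sigma>(2)[of x] mult_right_mono[of \<alpha> \<sigma> "norm x"] assms(2)[OF \<sigma>(1)] by simp
  have "x = 0" if "A *v x = 0" for x
    using ge[of x] that assms(1) by (simp add: mult_le_0_iff)
  then obtain B where "B ** A = mat 1"
    using matrix_left_invertible_ker[of A] by blast
  then have "\<exists>B. A ** B = mat 1 \<and> B ** A = mat 1" using matrix_left_right_inverse by blast
  from someI_ex[OF this] show 1: "A ** matrix_inv A = mat 1" and "matrix_inv A ** A = mat 1"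
    unfolding matrix_inv_def by blast+
  have "\<alpha> * norm (matrix_inv A *v axis s 1) \<le> norm (A *v (matrix_inv A *v axis s 1))"
    by (rule ge)
  also have "\<dots> = norm (axis s (1::complex) :: complex^'n)" by (simp add: matrix_vector_mul_assoc 1)
  also have "\<dots> = 1" by simp
  finally have "norm (matrix_inv A *v axis s 1) \<le> 1 / \<alpha>" using assms(1) by (simp add: field_simps)
  moreover have "matrix_inv A $ r $ s = (matrix_inv A *v axis s 1) $ r"
    by (simp add: matrix_vector_mult_axis)
  moreover have "cmod ((matrix_inv A *v axis s 1) $ r) \<le> norm (matrix_inv A *v axis s 1)"
    by (rule Finite_Cartesian_Product.norm_nth_le)
  ultimately show "cmod (matrix_inv A $ r $ s) \<le> 1 / \<alpha>" by simp
qed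

text \<open>Column s of the inverse solves a linear system with right-hand side
  \<open>axis s 1\<close>. Determinants are polynomials in the entries, so this formula passes
  measurability on to the inverse.\<close>

lemma matrix_inv_cramer:
  fixes A :: "'a::field^'n::finite^'n"
  assumes "A ** matrix_inv A = mat 1"
  shows "matrix_inv A $ r $ s = det (\<chi> i j. if j = r then axis s 1 $ i else A $ i $ j) / det A"
proof -
  have "det A * det (matrix_inv A) = 1"
    using arg_cong[OF assms, of det] by (simp add: det_mul)
  then have "det A \<noteq> 0" by auto
  moreover have "A *v (matrix_inv A *v axis s 1) = axis s 1"
    by (simp add: matrix_vector_mul_assoc assms)
  ultimately have "matrix_inv A *v axis s 1 =
      (\<chi> k. det (\<chi> i j. if j = k then axis s 1 $ i else A $ i $ j) / det A)"
    by (simp add: cramer)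
  moreover have "matrix_inv A $ r $ s = (matrix_inv A *v axis s 1) $ r"
    by (simp add: matrix_vector_mult_axis)
  ultimately show ?thesis by simp
qed

lemma borel_measurable_det:
  fixes A :: "'a \<Rightarrow> complex^'n::finite^'n"
  assumes "\<And>i j. (\<lambda>x. A x $ i $ j) \<in> borel_measurable N"
  shows "(\<lambda>x. det (A x)) \<in> borel_measurable N"
  unfolding det_def using assms by (intro borel_measurable_sum borel_measurable_times borel_measurable_prod) auto

section \<open>Lattices and fundamental domains\<close>

lemma vimage_translation_eq: "{x. x + t \<in> S} = (+) (- t) ` S" for t :: "'a::ab_group_add"
proof -
  have "x \<in> (+) (- t) ` S" if "x + t \<in> S" for x
    using that by (intro image_eqI[of _ _ "x + t"]) auto
  then show ?thesis by auto
qed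

lemma lebesgue_sets_vimage_translation:
  "S \<in> sets lebesgue \<Longrightarrow> {x. x + t \<in> S} \<in> sets lebesgue" for t :: "'a::euclidean_space"
  unfolding vimage_translation_eq by (rule lebesgue_sets_translation)

lemma emeasure_lebesgue_vimage_translation:
  "emeasure lebesgue {x. x + t \<in> S} = emeasure lebesgue S" for t :: "'a::euclidean_space"
  unfolding vimage_translation_eq
  using emeasure_lebesgue_affine[of 1 "- t" S] by (simp add: add.commute cong: image_cong_simp)

lemma emeasure_lebesgue_restrict_AE:
  assumes "A \<in> sets lebesgue" "B \<in> sets lebesgue" "AE x in lebesgue. x \<in> B"
  shows "emeasure lebesgue (A \<inter> B) = emeasure lebesgue A"
  by (rule emeasure_eq_AE) (use assms in auto)

text \<open>The indicator agrees almost everywhere with the constant 1, and Lebesgue measure is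
  complete. The set \<open>regular\<close> below, defined by unique existence, is measurable for
  this reason.\<close>

lemma AE_imp_sets_lebesgue:
  assumes "AE x in lebesgue. P x"
  shows "{x::'a::euclidean_space. P x} \<in> sets lebesgue"
proof -
  have "(\<lambda>x::'a. indicator {x. P x} x :: real) \<in> borel_measurable lebesgue"
    by (rule borel_measurable_AE[of "\<lambda>x. 1"]) (use assms in \<open>auto elim!: eventually_mono\<close>)
  then show ?thesis by (simp add: borel_measurable_indicator_iff)
qed

lemma expo_add_left: "expo (l + l') x = expo l x * expo l' x"
  and expo_add_right: "expo l (x + y) = expo l x * expo l y"
  and cnj_expo: "cnj (expo l x) = expo (- l) x"
  and expo_zero: "expo 0 x = 1"
  by (simp_all add: expo_def inner_add_left inner_add_right exp_add algebra_simps exp_cnj)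

lemma norm_expo [simp]: "cmod (expo l x) = 1"
proof -
  have "expo l x = cis (2 * pi * (l \<bullet> x))"
    by (simp add: expo_def cis_conv_exp mult_ac)
  then show ?thesis by simp
qed

lemma continuous_expo: "continuous_on S (expo l)"
  unfolding expo_def by (intro continuous_intros)

lemma expo_Ints:
  assumes "l \<bullet> x \<in> \<int>"
  shows "expo l x = 1"
proof -
  obtain n where "l \<bullet> x = of_int n" using assms by (auto elim: Ints_cases)
  then have "expo l x = cis (2 * pi * of_int n)"
    by (simp add: expo_def cis_conv_exp mult_ac)
  then show ?thesis by (simp add: cis_multiple_2pi)
qed

section \<open>The lattice, its cell and reduction modulo the lattice\<close>

locale real_lattice =
  fixes M :: "real^'d^'d"
  assumes invertible: "invertible M"
begin

abbreviation "\<Lambda> \<equiv> lattice M"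
abbreviation "Cell \<equiv> fund_parallelepiped M"

definition coords :: "real^'d \<Rightarrow> real^'d" where
  "coords x = matrix_inv M *v x"

lemma matrix_inv_M: "M ** matrix_inv M = mat 1" "matrix_inv M ** M = mat 1"
  using someI_ex[OF invertible[unfolded invertible_def]] unfolding matrix_inv_def by auto

lemma coords_M [simp]: "coords (M *v t) = t" and M_coords [simp]: "M *v coords x = x"
  by (simp_all add: coords_def matrix_vector_mul_assoc matrix_inv_M)

lemma coords_add: "coords (x + y) = coords x + coords y"
  and coords_diff: "coords (x - y) = coords x - coords y"
  by (simp_all add: coords_def matrix_vector_right_distrib matrix_vector_mult_diff_distrib)

lemma continuous_coords: "continuous_on S coords"
  unfolding coords_def[abs_def]
  by (intro linear_continuous_on linear_conv_bounded_linear[THEN iffD1] matrix_vector_mul_linear)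

lemma lattice_iff: "l \<in> \<Lambda> \<longleftrightarrow> (\<forall>i. coords l $ i \<in> \<int>)"
  unfolding lattice_def by (auto intro!: exI[of _ "coords l"])

lemma cell_iff: "x \<in> Cell \<longleftrightarrow> (\<forall>i. 0 \<le> coords x $ i \<and> coords x $ i < 1)"
  unfolding fund_parallelepiped_def by (auto intro!: exI[of _ "coords x"])

lemma zero_in_lattice: "0 \<in> \<Lambda>"
  by (simp add: lattice_iff coords_def)

lemma lattice_add: "l \<in> \<Lambda> \<Longrightarrow> l' \<in> \<Lambda> \<Longrightarrow> l + l' \<in> \<Lambda>"
  by (simp add: lattice_iff coords_add)

lemma lattice_diff: "l \<in> \<Lambda> \<Longrightarrow> l' \<in> \<Lambda> \<Longrightarrow> l - l' \<in> \<Lambda>"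
  by (simp add: lattice_iff coords_diff)

lemma countable_lattice: "countable \<Lambda>"
proof -
  have "countable {z :: real^'d. \<forall>i. z $ i \<in> \<int>}"
    by (rule countable_vector) (simp add: Ints_def)
  then show ?thesis unfolding lattice_def by (simp add: setcompr_eq_image)
qed

lemma cell_unique:
  assumes "x \<in> Cell" "y \<in> Cell" "x - y \<in> \<Lambda>"
  shows "x = y"
proof -
  have "coords x $ i = coords y $ i" for i
  proof -
    have "coords x $ i - coords y $ i \<in> \<int>" using assms(3) by (simp add: lattice_iff coords_diff)
    then obtain n where n: "coords x $ i - coords y $ i = of_int n" by (elim Ints_cases)
    moreover have "\<bar>coords x $ i - coords y $ i\<bar> < 1"
      using assms(1,2) unfolding cell_iff by (smt (verit))
    ultimately have "n = 0" by linarith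
    then show ?thesis using n by simp
  qed
  then show ?thesis by (metis M_coords vec_eq_iff)
qed

text \<open>In lattice coordinates this takes fractional parts. The same map inverts the shift into
  every fundamental domain, up to null sets.\<close>

definition reduce :: "real^'d \<Rightarrow> real^'d" where
  "reduce x = x - M *v (\<chi> i. of_int \<lfloor>coords x $ i\<rfloor>)"

lemma reduce_in_cell: "reduce x \<in> Cell"
proof -
  have "coords (reduce x) $ i = frac (coords x $ i)" for i
    by (simp add: reduce_def coords_diff frac_def)
  then show ?thesis by (simp add: cell_iff frac_ge_0 frac_lt_1)
qed

lemma diff_reduce_in_lattice: "x - reduce x \<in> \<Lambda>"
  by (simp add: reduce_def lattice_iff)

lemma reduce_eqI: "y \<in> Cell \<Longrightarrow> x - y \<in> \<Lambda> \<Longrightarrow> reduce x = y"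
  using lattice_diff[of "x - y" "x - reduce x"] diff_reduce_in_lattice[of x] reduce_in_cell[of x]
  by (intro cell_unique) auto

lemma sets_cell_borel: "Cell \<in> sets borel"
proof -
  have "(\<lambda>x. coords x $ i) \<in> borel_measurable borel" for i
    by (intro borel_measurable_continuous_onI continuous_on_component continuous_coords)
  then have "{x. \<forall>i. 0 \<le> coords x $ i \<and> coords x $ i < 1} \<in> sets borel"
    by measurable
  then show ?thesis unfolding cell_iff[symmetric] by simp
qed

lemma sets_cell: "Cell \<in> sets lebesgue"
  using sets_cell_borel by (intro sets_completionI_sets) simp

lemma bounded_cell: "bounded Cell"
proof -
  have "Cell \<subseteq> (*v) M ` cbox 0 1"
    by (rule subsetI, rule_tac x = "coords x" in image_eqI)
      (auto simp: cell_iff mem_box_cart less_imp_le)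
  moreover have "bounded ((*v) M ` cbox 0 1)"
    by (intro bounded_linear_image bounded_cbox matrix_vector_mul_bounded_linear)
  ultimately show ?thesis by (rule bounded_subset[rotated])
qed

lemma lmeasurable_cell: "Cell \<in> lmeasurable"
  by (rule bounded_set_imp_lmeasurable[OF bounded_cell sets_cell])

text \<open>A countable union of translates, which gives both the measurability of
  \<open>reduce\<close> and the measure of its preimages.\<close>

lemma vimage_reduce_eq: "B \<subseteq> Cell \<Longrightarrow> reduce -` B = (\<Union>l\<in>\<Lambda>. {x. x + (- l) \<in> B})"
proof (intro equalityI subsetI)
  fix x assume "B \<subseteq> Cell" "x \<in> reduce -` B"
  then show "x \<in> (\<Union>l\<in>\<Lambda>. {x. x + (- l) \<in> B})"
    using diff_reduce_in_lattice[of x] by (auto intro!: bexI[of _ "x - reduce x"])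
next
  fix x assume "B \<subseteq> Cell" "x \<in> (\<Union>l\<in>\<Lambda>. {x. x + (- l) \<in> B})"
  then obtain l where l: "l \<in> \<Lambda>" "x - l \<in> B" "x - l \<in> Cell" by auto
  then have "reduce x = x - l" by (intro reduce_eqI) auto
  then show "x \<in> reduce -` B" using l by simp
qed

text \<open>Together with \<open>distr_reduce\<close> this makes the integral of a periodic function
  over a translated cell independent of the translation; see
  \<open>integral_expo_cell\<close>.\<close>

lemma fundamental_domain_cell_translate: "fundamental_domain \<Lambda> {x. x + t \<in> Cell}"
  unfolding fundamental_domain_def
proof
  show "{x. x + t \<in> Cell} \<in> sets lebesgue"
    by (intro lebesgue_sets_vimage_translation sets_cell)
  have "\<exists>!l. l \<in> \<Lambda> \<and> x + l \<in> {x. x + t \<in> Cell}" for x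
  proof (rule ex1I[of _ "reduce (x + t) - (x + t)"])
    show "reduce (x + t) - (x + t) \<in> \<Lambda> \<and> x + (reduce (x + t) - (x + t)) \<in> {x. x + t \<in> Cell}"
      using diff_reduce_in_lattice[of "x + t"] lattice_diff[OF zero_in_lattice, of "x + t - reduce (x + t)"]
      by (simp add: reduce_in_cell)
    fix l assume l: "l \<in> \<Lambda> \<and> x + l \<in> {x. x + t \<in> Cell}"
    then have "reduce (x + t) = x + l + t"
      using lattice_diff[OF zero_in_lattice, of l] by (intro reduce_eqI) auto
    then show "l = reduce (x + t) - (x + t)" by (simp add: algebra_simps)
  qed
  then show "AE x in lebesgue. \<exists>!l. l \<in> \<Lambda> \<and> x + l \<in> {x. x + t \<in> Cell}" by simp
qed

lemma measure_cell_pos: "0 < measure lebesgue Cell"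
proof (rule ccontr)
  assume "\<not> 0 < measure lebesgue Cell"
  then have null: "emeasure lebesgue Cell = 0"
    using lmeasurable_cell measure_nonneg[of lebesgue Cell]
    by (simp add: emeasure_eq_measure2 less_le)
  have "(\<Union>l\<in>\<Lambda>. {x. x + (- l) \<in> Cell}) \<in> null_sets lebesgue"
    by (intro null_sets_UN' countable_lattice null_setsI lebesgue_sets_vimage_translation sets_cell)
      (simp only: emeasure_lebesgue_vimage_translation null)
  moreover have "reduce -` Cell = UNIV" using reduce_in_cell by auto
  ultimately have "(UNIV :: (real^'d) set) \<in> null_sets lebesgue"
    using vimage_reduce_eq[of Cell] by simp
  then show False by (simp add: null_sets_def)
qed

section \<open>One fundamental domain compared with the cell\<close>

context
  fixes D :: "(real^'d) set"
  assumes D: "fundamental_domain \<Lambda> D"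
begin

definition regular :: "(real^'d) set" where
  "regular = {x. \<exists>!l. l \<in> \<Lambda> \<and> x + l \<in> D}"

lemma sets_D: "D \<in> sets lebesgue"
  using D by (simp add: fundamental_domain_def)

lemma AE_regular: "AE x in lebesgue. x \<in> regular"
  using D by (simp add: fundamental_domain_def regular_def)

lemma sets_regular: "regular \<in> sets lebesgue"
  using AE_imp_sets_lebesgue[OF AE_regular] by simp

text \<open>Regularity depends only on the class of x modulo the lattice, so it survives
  \<open>reduce\<close>.\<close>

lemma regular_shift: "x \<in> regular \<Longrightarrow> l \<in> \<Lambda> \<Longrightarrow> x + l \<in> regular"
proof -
  assume "x \<in> regular" and l: "l \<in> \<Lambda>"
  then obtain k where k: "k \<in> \<Lambda>" "x + k \<in> D" and
    u: "\<And>k'. k' \<in> \<Lambda> \<Longrightarrow> x + k' \<in> D \<Longrightarrow> k' = k" by (auto simp: regular_def)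
  show "x + l \<in> regular"
    unfolding regular_def
  proof (rule CollectI, rule ex1I[of _ "k - l"])
    show "k - l \<in> \<Lambda> \<and> x + l + (k - l) \<in> D" using k l lattice_diff by simp
    show "k' = k - l" if "k' \<in> \<Lambda> \<and> x + l + k' \<in> D" for k'
      using u[of "l + k'"] that l lattice_add by (simp add: algebra_simps)
  qed
qed

lemma lattice_shift_eqI: "x \<in> regular \<Longrightarrow> l \<in> \<Lambda> \<Longrightarrow> x + l \<in> D \<Longrightarrow> lattice_shift \<Lambda> D x = l"
  unfolding lattice_shift_def regular_def by (auto intro!: the1_equality)

lemma regularE:
  assumes "x \<in> regular"
  obtains "lattice_shift \<Lambda> D x \<in> \<Lambda>" "x + lattice_shift \<Lambda> D x \<in> D"
  using assms lattice_shift_eqI[OF assms] unfolding regular_def by blast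

text \<open>The default value 0 off \<open>regular\<close> is itself a lattice point, so this holds
  without any exceptional set.\<close>

lemma lattice_shift_in_lattice: "lattice_shift \<Lambda> D x \<in> \<Lambda>"
proof (cases "x \<in> regular")
  case True
  then show ?thesis by (rule regularE)
next
  case False
  then show ?thesis by (simp add: regular_def lattice_shift_def zero_in_lattice)
qed

lemma measurable_reduce: "reduce \<in> measurable (lebesgue_on D) (lebesgue_on Cell)"
proof (rule measurableI)
  fix B assume "B \<in> sets (lebesgue_on Cell)"
  then have B: "B \<in> sets lebesgue" "B \<subseteq> Cell"
    using sets_cell by (auto simp: sets_restrict_space_iff)
  then have "reduce -` B \<in> sets lebesgue"
    unfolding vimage_reduce_eq[OF B(2)]
    by (intro sets.countable_UN' countable_lattice image_subsetI lebesgue_sets_vimage_translation B)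
  then show "reduce -` B \<inter> space (lebesgue_on D) \<in> sets (lebesgue_on D)"
    using sets_D by (auto simp: sets_restrict_space_iff space_restrict_space)
qed (simp add: reduce_in_cell)

text \<open>A cut-and-translate argument: the part of D that reduces to B falls into pieces, one for
  each lattice vector, and translating them back reassembles B up to a null set. Disjointness of the
  pieces before translation comes from uniqueness in the cell, and after it from uniqueness in
  D.\<close>

lemma emeasure_vimage_reduce:
  assumes B: "B \<in> sets lebesgue" "B \<subseteq> Cell"
  shows "emeasure lebesgue (reduce -` B \<inter> D) = emeasure lebesgue B"
proof -
  have "reduce -` B \<inter> D = (\<Union>l\<in>\<Lambda>. {x. x + (- l) \<in> B} \<inter> D)"
    using vimage_reduce_eq[OF B(2)] by auto
  moreover have "disjoint_family_on (\<lambda>l. {x. x + (- l) \<in> B} \<inter> D) \<Lambda>"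
    unfolding disjoint_family_on_def
  proof (intro ballI impI)
    fix l l' assume l: "l \<in> \<Lambda>" "l' \<in> \<Lambda>" "l \<noteq> l'"
    have False if "x - l \<in> B" "x - l' \<in> B" for x
      using cell_unique[of "x - l" "x - l'"] that B(2) l lattice_diff[of l' l] by auto
    then show "{x. x + (- l) \<in> B} \<inter> D \<inter> ({x. x + (- l') \<in> B} \<inter> D) = {}" by auto
  qed
  ultimately have "emeasure lebesgue (reduce -` B \<inter> D) =
      (\<integral>\<^sup>+l. emeasure lebesgue ({x. x + (- l) \<in> B} \<inter> D) \<partial>count_space \<Lambda>)"
    by (simp only:, intro emeasure_UN_countable countable_lattice sets.Int
        lebesgue_sets_vimage_translation B sets_D)
  \<comment> \<open>The piece with index l is moved back by l. Points outside \<open>regular\<close>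
    are removed because there the moved pieces could overlap or leave gaps.\<close>
  also have "\<dots> = (\<integral>\<^sup>+l. emeasure lebesgue ({x. x + l \<in> D} \<inter> B \<inter> regular) \<partial>count_space \<Lambda>)"
  proof (rule nn_integral_cong)
    fix l
    have "{x. x + l \<in> {x. x + (- l) \<in> B} \<inter> D} = {x. x + l \<in> D} \<inter> B" by auto
    then show "emeasure lebesgue ({x. x + (- l) \<in> B} \<inter> D) =
        emeasure lebesgue ({x. x + l \<in> D} \<inter> B \<inter> regular)"
      using emeasure_lebesgue_vimage_translation[of l "{x. x + (- l) \<in> B} \<inter> D"]
        emeasure_lebesgue_restrict_AE[OF _ sets_regular AE_regular, of "{x. x + l \<in> D} \<inter> B"]
        lebesgue_sets_vimage_translation[OF sets_D, of l] B by simp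
  qed
  also have "\<dots> = emeasure lebesgue (\<Union>l\<in>\<Lambda>. {x. x + l \<in> D} \<inter> B \<inter> regular)"
  proof (intro emeasure_UN_countable[symmetric] countable_lattice sets.Int
        lebesgue_sets_vimage_translation B sets_D sets_regular)
    show "disjoint_family_on (\<lambda>l. {x. x + l \<in> D} \<inter> B \<inter> regular) \<Lambda>"
      unfolding disjoint_family_on_def regular_def by blast
  qed
  also have "(\<Union>l\<in>\<Lambda>. {x. x + l \<in> D} \<inter> B \<inter> regular) = B \<inter> regular"
    unfolding regular_def by blast
  also have "emeasure lebesgue \<dots> = emeasure lebesgue B"
    by (rule emeasure_lebesgue_restrict_AE[OF B(1) sets_regular AE_regular])
  finally show ?thesis .
qed

lemma distr_reduce: "distr (lebesgue_on D) (lebesgue_on Cell) reduce = lebesgue_on Cell"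
proof (rule measure_eqI)
  fix B assume "B \<in> sets (distr (lebesgue_on D) (lebesgue_on Cell) reduce)"
  then have B': "B \<in> sets (lebesgue_on Cell)" and B: "B \<in> sets lebesgue" "B \<subseteq> Cell"
    using sets_cell by (auto simp: sets_restrict_space_iff)
  have "emeasure (distr (lebesgue_on D) (lebesgue_on Cell) reduce) B =
      emeasure (lebesgue_on D) (reduce -` B \<inter> D)"
    using emeasure_distr[OF measurable_reduce B'] by (simp add: space_restrict_space)
  also have "\<dots> = emeasure lebesgue (reduce -` B \<inter> D)"
    using sets_D by (intro emeasure_restrict_space) auto
  also have "\<dots> = emeasure lebesgue B" by (rule emeasure_vimage_reduce[OF B])
  also have "\<dots> = emeasure (lebesgue_on Cell) B"
    using sets_cell B(2) by (intro emeasure_restrict_space[symmetric]) auto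
  finally show "emeasure (distr (lebesgue_on D) (lebesgue_on Cell) reduce) B =
      emeasure (lebesgue_on Cell) B" .
qed simp

text \<open>Agrees with \<open>shift_into\<close> almost everywhere, but maps into \<open>D\<close> without exception, as
  measurability with respect to \<open>lebesgue_on D\<close> requires.\<close>
definition domain_section :: "real^'d \<Rightarrow> real^'d" where
  "domain_section x = (if x \<in> regular then x + lattice_shift \<Lambda> D x else (SOME d. d \<in> D))"

lemma domain_section_in: "domain_section x \<in> D"
proof -
  have "D \<noteq> {}"
  proof
    assume "D = {}"
    then have "AE x::real^'d in lebesgue. False"
      using D by (simp add: fundamental_domain_def Ex1_def)
    then have "(UNIV :: (real^'d) set) \<in> null_sets lebesgue"
      by (subst (asm) AE_iff_null) auto
    then show False by (simp add: null_sets_def)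
  qed
  then show ?thesis
    unfolding domain_section_def by (auto elim: regularE intro: someI)
qed

lemma reduce_regular: "x \<in> regular \<Longrightarrow> reduce x \<in> regular"
  using regular_shift[OF _ lattice_diff[OF zero_in_lattice diff_reduce_in_lattice], of x x] by simp

lemma domain_section_reduce: "x \<in> D \<Longrightarrow> x \<in> regular \<Longrightarrow> domain_section (reduce x) = x"
proof -
  assume x: "x \<in> D" "x \<in> regular"
  have l: "x - reduce x \<in> \<Lambda>" by (rule diff_reduce_in_lattice)
  have reg: "reduce x \<in> regular" by (rule reduce_regular[OF x(2)])
  have "lattice_shift \<Lambda> D (reduce x) = x - reduce x"
    by (rule lattice_shift_eqI[OF reg l]) (simp add: x)
  then show ?thesis using reg by (simp add: domain_section_def)
qed

lemma shift_back_domain_section: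
  assumes "y \<in> Cell" "y \<in> regular"
  shows "shift_back M D (domain_section y) = y"
  unfolding shift_back_def the_inv_into_def
proof (rule the_equality)
  show "y \<in> Cell \<and> shift_into \<Lambda> D y = domain_section y"
    using assms by (simp add: shift_into_def domain_section_def)
next
  \<comment> \<open>The point z need not be regular. If it is not, its shift is the default 0, still
    a lattice point, so z and y are congruent in either case and therefore equal.\<close>
  fix z assume z: "z \<in> Cell \<and> shift_into \<Lambda> D z = domain_section y"
  then have "z - y = lattice_shift \<Lambda> D y - lattice_shift \<Lambda> D z"
    using assms by (simp add: shift_into_def domain_section_def algebra_simps)
  then have "z - y \<in> \<Lambda>" using lattice_shift_in_lattice lattice_diff by simp
  then show "z = y" using z assms by (intro cell_unique) auto
qed

text \<open>This turns the inverse of \<omega>_r in the definition of \<open>g\<close> into a map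
  that does not depend on r.\<close>

lemma shift_back_eq_reduce: "x \<in> D \<Longrightarrow> x \<in> regular \<Longrightarrow> shift_back M D x = reduce x"
  by (metis domain_section_reduce reduce_in_cell reduce_regular shift_back_domain_section)

lemma measurable_domain_section: "domain_section \<in> measurable (lebesgue_on Cell) (lebesgue_on D)"
proof (rule measurableI)
  fix A assume "A \<in> sets (lebesgue_on D)"
  then have A: "A \<in> sets lebesgue" "A \<subseteq> D"
    using sets_D by (auto simp: sets_restrict_space_iff)
  \<comment> \<open>Regular points are sorted by the lattice vector that carries them into A; all
    other points of the cell share the single default value.\<close>
  have "domain_section -` A \<inter> space (lebesgue_on Cell) =
     (\<Union>l\<in>\<Lambda>. {x. x + l \<in> A} \<inter> regular \<inter> Cell) \<union> (if (SOME d. d \<in> D) \<in> A then Cell - regular else {})"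
    (is "?L = ?R")
  proof (intro equalityI subsetI)
    fix x assume x: "x \<in> ?L"
    then show "x \<in> ?R"
      using lattice_shift_in_lattice[of x]
      by (cases "x \<in> regular") (auto simp: domain_section_def space_restrict_space)
  next
    fix x assume "x \<in> ?R"
    then show "x \<in> ?L"
      using lattice_shift_eqI[of x] A(2)
      by (auto simp: domain_section_def space_restrict_space split: if_splits)
  qed
  moreover have "?R \<in> sets lebesgue"
    using A sets_cell sets_regular
    by (intro sets.Un sets.countable_UN' countable_lattice)
       (auto intro!: lebesgue_sets_vimage_translation sets.Diff)
  moreover have "?L \<subseteq> Cell" by (auto simp: space_restrict_space)
  ultimately show "?L \<in> sets (lebesgue_on Cell)"
    using sets_cell by (simp add: sets_restrict_space_iff)
qed (use domain_section_in in \<open>auto simp: space_restrict_space\<close>)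

text \<open>The measure of the cell is the image of that of D under \<open>reduce\<close>, and
  reducing and then taking the section is almost everywhere the identity on D.\<close>

lemma distr_domain_section: "distr (lebesgue_on Cell) (lebesgue_on D) domain_section = lebesgue_on D"
proof -
  have "distr (lebesgue_on Cell) (lebesgue_on D) domain_section =
        distr (distr (lebesgue_on D) (lebesgue_on Cell) reduce) (lebesgue_on D) domain_section"
    by (simp add: distr_reduce)
  also have "\<dots> = distr (lebesgue_on D) (lebesgue_on D) (domain_section \<circ> reduce)"
    by (rule distr_distr[OF measurable_domain_section measurable_reduce])
  also have "\<dots> = distr (lebesgue_on D) (lebesgue_on D) (\<lambda>x. x)"
  proof (rule distr_cong_AE)
    show "AE x in lebesgue_on D. (domain_section \<circ> reduce) x = x"
      using AE_regular sets_D
      by (subst AE_restrict_space_iff) (auto elim!: eventually_mono simp: domain_section_reduce)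
  qed (use measurable_comp[OF measurable_reduce measurable_domain_section] in auto)
  also have "\<dots> = lebesgue_on D" by (rule distr_id)
  finally show ?thesis .
qed

lemma AE_regular_cell: "AE y in lebesgue_on Cell. y \<in> Cell \<and> y \<in> regular"
  using AE_regular sets_cell by (subst AE_restrict_space_iff) (auto elim: eventually_mono)

text \<open>At regular points the shift is the section minus the identity, so it inherits
  measurability from the section.\<close>

lemma borel_measurable_lattice_shift: "lattice_shift \<Lambda> D \<in> borel_measurable (lebesgue_on Cell)"
proof -
  have id: "(\<lambda>x. x) \<in> borel_measurable (lebesgue_on S)" for S :: "(real^'d) set"
    by (intro measurable_restrict_space1 measurable_completion) simp
  have "domain_section \<in> borel_measurable (lebesgue_on Cell)"
    using measurable_compose[OF measurable_domain_section id] by simp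
  moreover have "regular \<inter> Cell \<in> sets (lebesgue_on Cell)"
    using sets_regular sets_cell by (simp add: sets_restrict_space_iff)
  ultimately have "(\<lambda>x. if x \<in> regular \<inter> Cell then domain_section x - x else 0)
      \<in> borel_measurable (lebesgue_on Cell)"
    using id by (intro measurable_If_set borel_measurable_diff) (auto simp: space_restrict_space)
  moreover have "lattice_shift \<Lambda> D x = (if x \<in> regular \<inter> Cell then domain_section x - x else 0)"
    if "x \<in> Cell" for x
    using that by (auto simp: domain_section_def lattice_shift_def regular_def)
  ultimately show ?thesis
    by (subst measurable_cong) (auto simp: space_restrict_space)
qed

end

section \<open>The dual lattice and its periodic exponentials\<close>

lemma dual_lattice_inner: "l \<in> dual_lattice M \<Longrightarrow> x \<in> \<Lambda> \<Longrightarrow> l \<bullet> x \<in> \<int>"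
proof -
  assume l: "l \<in> dual_lattice M" and x: "x \<in> \<Lambda>"
  obtain z where z: "l = transpose (matrix_inv M) *v z" "\<forall>i. z $ i \<in> \<int>"
    using l by (auto simp: dual_lattice_def lattice_def)
  have "l \<bullet> x = z \<bullet> coords x"
    by (simp add: z(1) dot_lmul_matrix coords_def)
  also have "\<dots> = (\<Sum>i\<in>UNIV. z $ i * coords x $ i)" by (simp add: inner_vec_def)
  also have "\<dots> \<in> \<int>" using z(2) x by (intro Ints_sum Ints_mult) (auto simp: lattice_iff)
  finally show ?thesis .
qed

lemma dual_lattice_add: "l \<in> dual_lattice M \<Longrightarrow> l' \<in> dual_lattice M \<Longrightarrow> l + l' \<in> dual_lattice M"
  and dual_lattice_uminus: "l \<in> dual_lattice M \<Longrightarrow> - l \<in> dual_lattice M"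
  and zero_in_dual_lattice: "0 \<in> dual_lattice M"
proof -
  let ?N = "transpose (matrix_inv M)"
  show "l + l' \<in> dual_lattice M" if l: "l \<in> dual_lattice M" "l' \<in> dual_lattice M"
  proof -
    obtain z z' where "l = ?N *v z" "\<forall>i. z $ i \<in> \<int>" "l' = ?N *v z'" "\<forall>i. z' $ i \<in> \<int>"
      using l unfolding dual_lattice_def lattice_def by blast
    then have "l + l' = ?N *v (z + z')" "\<forall>i. (z + z') $ i \<in> \<int>"
      by (simp_all only: matrix_vector_right_distrib vector_add_component Ints_add) simp_all
    then show ?thesis unfolding dual_lattice_def lattice_def by blast
  qed
  show "- l \<in> dual_lattice M" if l: "l \<in> dual_lattice M"
  proof -
    obtain z where "l = ?N *v z" "\<forall>i. z $ i \<in> \<int>"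
      using l unfolding dual_lattice_def lattice_def by blast
    then have "- l = ?N *v (0 - z)" "\<forall>i. (0 - z) $ i \<in> \<int>"
      by (simp_all only: matrix_vector_mult_diff_distrib matrix_vector_mult_0_right) simp_all
    then show ?thesis unfolding dual_lattice_def lattice_def by blast
  qed
  show "0 \<in> dual_lattice M"
    unfolding dual_lattice_def lattice_def by (intro CollectI exI[of _ 0]) simp
qed

lemma countable_dual_lattice: "countable (dual_lattice M)"
proof -
  have "countable {z :: real^'d. \<forall>i. z $ i \<in> \<int>}"
    by (rule countable_vector) (simp add: Ints_def)
  then show ?thesis unfolding dual_lattice_def lattice_def by (simp add: setcompr_eq_image)
qed

lemma expo_periodic: "l \<in> dual_lattice M \<Longrightarrow> x \<in> \<Lambda> \<Longrightarrow> expo l x = 1"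
  by (simp add: expo_Ints dual_lattice_inner)

lemma expo_reduce: "l \<in> dual_lattice M \<Longrightarrow> expo l (reduce x) = expo l x"
  using expo_add_right[of l "reduce x" "x - reduce x"] expo_periodic[OF _ diff_reduce_in_lattice, of l x]
  by simp

lemma borel_measurable_expo: "expo l \<in> borel_measurable (lebesgue_on S)"
  by (intro measurable_restrict_space1 measurable_completion)
    (simp add: borel_measurable_continuous_onI continuous_expo)

text \<open>A translation by t with l \<bullet> t = 1/2 changes the sign of the exponential. By
  periodicity the integral over the translated cell is the same as over the cell, so the integral
  equals its own negative.\<close>

lemma integral_expo_cell:
  assumes l: "l \<in> dual_lattice M" "l \<noteq> 0"
  shows "(LINT x|lebesgue_on Cell. expo l x) = 0"
proof -
  define t where "t = (1 / (2 * (l \<bullet> l))) *\<^sub>R l"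
  have "l \<bullet> t = 1 / 2" using l(2) by (simp add: t_def)
  then have "expo l t = exp (2 * of_real pi * \<i> * of_real (1 / 2))"
    by (simp only: expo_def)
  also have "\<dots> = - 1" by simp
  finally have t: "expo l t = - 1" .
  let ?D = "{x. x + t \<in> Cell}"
  have D: "fundamental_domain \<Lambda> ?D" by (rule fundamental_domain_cell_translate)
  \<comment> \<open>Borel measurability lets the integral pass from \<open>lebesgue\<close> to
    \<open>lborel\<close>, where it is translated.\<close>
  have ind: "(\<lambda>x. indicator Cell x *\<^sub>R expo l x) \<in> borel_measurable borel"
    by (intro borel_measurable_scaleR borel_measurable_indicator sets_cell_borel
        borel_measurable_continuous_onI continuous_expo)
  have "(\<lambda>x. t + x) \<in> borel_measurable borel" by simp
  from measurable_compose[OF this ind]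
  have ind_t: "(\<lambda>x. indicator Cell (t + x) *\<^sub>R expo l (t + x)) \<in> borel_measurable borel" .
  have "(LINT x|lebesgue_on Cell. expo l x) = (LINT x|distr (lebesgue_on ?D) (lebesgue_on Cell) reduce. expo l x)"
    by (simp add: distr_reduce[OF D])
  also have "\<dots> = (LINT x|lebesgue_on ?D. expo l x)"
    by (subst integral_distr[OF measurable_reduce[OF D] borel_measurable_expo]) (simp add: expo_reduce l)
  also have "\<dots> = (LINT x|lebesgue. indicator ?D x *\<^sub>R expo l x)"
    using D by (intro integral_restrict_space) (simp add: fundamental_domain_def)
  also have "(\<lambda>x. indicator ?D x *\<^sub>R expo l x) = (\<lambda>x. - (indicator Cell (t + x) *\<^sub>R expo l (t + x)))"
    by (rule ext) (simp add: expo_add_right t indicator_def add.commute)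
  also have "(LINT x|lebesgue. - (indicator Cell (t + x) *\<^sub>R expo l (t + x))) =
      - (LINT x|lborel. (indicator Cell (t + x) *\<^sub>R expo l (t + x)))"
    using ind_t by (subst Bochner_Integration.integral_minus, subst integral_completion) simp_all
  also have "(LINT x|lborel. (indicator Cell (t + x) *\<^sub>R expo l (t + x))) =
      (LINT x|distr lborel borel ((+) t). (indicator Cell x *\<^sub>R expo l x))"
    using ind by (intro integral_distr[symmetric]) simp_all
  also have "\<dots> = (LINT x|lborel. (indicator Cell x *\<^sub>R expo l x))"
    by (simp only: lborel_distr_plus)
  also have "\<dots> = (LINT x|lebesgue. (indicator Cell x *\<^sub>R expo l x))"
    using ind by (subst integral_completion) simp_all
  also have "\<dots> = (LINT x|lebesgue_on Cell. expo l x)"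
    using sets_cell by (intro integral_restrict_space[symmetric]) simp
  finally show ?thesis by simp
qed

end

section \<open>Completeness of the exponentials on the cell\<close>

context real_lattice
begin

text \<open>Generating the polynomials term by term gives closure under sums and products by
  induction, with no bookkeeping of coinciding frequencies; only \<open>trig_poly_sum\<close> has to
  merge them.\<close>

inductive trig_poly :: "(real^'d \<Rightarrow> complex) \<Rightarrow> bool" where
  trig_poly_zero: "trig_poly (\<lambda>x. 0)"
| trig_poly_step: "trig_poly f \<Longrightarrow> l \<in> dual_lattice M \<Longrightarrow> trig_poly (\<lambda>x. c * expo l x + f x)"

lemma trig_poly_sum:
  assumes "trig_poly f"
  shows "\<exists>F c. finite F \<and> F \<subseteq> dual_lattice M \<and> f = (\<lambda>x. \<Sum>l\<in>F. c l * expo l x)"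
  using assms
proof induction
  case trig_poly_zero
  show ?case by (rule exI[of _ "{}"]) simp
next
  case (trig_poly_step f l c)
  then obtain F d where F: "finite F" "F \<subseteq> dual_lattice M" "f = (\<lambda>x. \<Sum>l\<in>F. d l * expo l x)" by blast
  \<comment> \<open>If l already occurs in F, the new coefficient is added to the old one.\<close>
  define d' where "d' k = (if k = l then c else 0) + (if k \<in> F then d k else 0)" for k
  have "c * expo l x + f x = (\<Sum>k\<in>insert l F. d' k * expo k x)" for x
  proof -
    have "(\<Sum>k\<in>insert l F. d' k * expo k x) =
       (\<Sum>k\<in>insert l F. (if k = l then c * expo k x else 0)) +
       (\<Sum>k\<in>insert l F. (if k \<in> F then d k * expo k x else 0))"
      unfolding sum.distrib[symmetric] by (rule sum.cong) (auto simp: d'_def algebra_simps)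
    also have "(\<Sum>k\<in>insert l F. (if k = l then c * expo k x else 0)) = c * expo l x"
      using F(1) by simp
    also have "(\<Sum>k\<in>insert l F. (if k \<in> F then d k * expo k x else 0)) = (\<Sum>k\<in>F. d k * expo k x)"
      using F(1) by (intro sum.mono_neutral_cong_right) auto
    finally show ?thesis using F(3) by simp
  qed
  then show ?case using F trig_poly_step.hyps
    by (intro exI[of _ "insert l F"] exI[of _ d']) auto
qed

lemma trig_poly_add: "trig_poly f \<Longrightarrow> trig_poly g \<Longrightarrow> trig_poly (\<lambda>x. f x + g x)"
proof (induction rule: trig_poly.induct)
  case (trig_poly_step f l c)
  then have "trig_poly (\<lambda>x. c * expo l x + (f x + g x))" by (intro trig_poly.trig_poly_step)
  then show ?case by (simp add: add.assoc)
qed simp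

lemma trig_poly_expo_mult:
  assumes "trig_poly f" "l \<in> dual_lattice M"
  shows "trig_poly (\<lambda>x. c * expo l x * f x)"
  using assms
proof (induction rule: trig_poly.induct)
  case trig_poly_zero
  then show ?case by (simp add: trig_poly.trig_poly_zero)
next
  case (trig_poly_step f k d)
  have "trig_poly (\<lambda>x. (c * d) * expo (l + k) x + c * expo l x * f x)"
    using trig_poly_step by (intro trig_poly.trig_poly_step dual_lattice_add) auto
  then show ?case by (simp add: algebra_simps expo_add_left)
qed

lemma trig_poly_mult: "trig_poly f \<Longrightarrow> trig_poly g \<Longrightarrow> trig_poly (\<lambda>x. f x * g x)"
proof (induction rule: trig_poly.induct)
  case trig_poly_zero
  then show ?case by (simp add: trig_poly.trig_poly_zero)
next
  case (trig_poly_step f l c)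
  then have "trig_poly (\<lambda>x. c * expo l x * g x + f x * g x)"
    by (intro trig_poly_add trig_poly_expo_mult) auto
  then show ?case by (simp add: algebra_simps)
qed

lemma trig_poly_expo: "l \<in> dual_lattice M \<Longrightarrow> trig_poly (\<lambda>x. c * expo l x)"
  using trig_poly_step[OF trig_poly_zero, of l c] by simp

lemma trig_poly_const: "trig_poly (\<lambda>x. c)"
  using trig_poly_expo[OF zero_in_dual_lattice, of c] by (simp add: expo_zero)

lemma trig_poly_cmult: "trig_poly f \<Longrightarrow> trig_poly (\<lambda>x. c * f x)"
  using trig_poly_expo_mult[OF _ zero_in_dual_lattice, of f c] by (simp add: expo_zero)

section \<open>Uniform approximation on the torus\<close>

definition dual_axis :: "'d \<Rightarrow> real^'d" where
  "dual_axis i = transpose (matrix_inv M) *v axis i 1"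

lemma dual_axis_in_dual_lattice: "dual_axis i \<in> dual_lattice M"
  unfolding dual_lattice_def lattice_def dual_axis_def
  by (rule CollectI, rule exI[of _ "axis i 1"]) (simp add: axis_def)

lemma dual_axis_inner: "dual_axis i \<bullet> x = coords x $ i"
  by (simp add: dual_axis_def dot_lmul_matrix coords_def inner_axis')

lemma dual_axis_nonzero: "dual_axis i \<noteq> 0"
proof
  assume "dual_axis i = 0"
  moreover have "dual_axis i \<bullet> (M *v axis i 1) = 1"
    unfolding dual_axis_inner coords_M by (simp add: axis_def)
  ultimately show False by (metis inner_zero_left zero_neq_one)
qed

text \<open>The quotient map modulo the lattice, realised inside complex space so that its range is
  compact and coordinate functions separate its points.\<close>

definition torus_map :: "real^'d \<Rightarrow> complex^'d" where
  "torus_map x = (\<chi> i. expo (dual_axis i) x)"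

lemma continuous_torus_map: "continuous_on S torus_map"
  unfolding torus_map_def by (intro continuous_on_vec_lambda continuous_expo)

lemma torus_map_eq_imp:
  assumes "torus_map x = torus_map y"
  shows "coords x $ i - coords y $ i \<in> \<int>"
proof -
  have "expo (dual_axis i) x = expo (dual_axis i) y"
    using assms by (simp add: torus_map_def vec_eq_iff)
  moreover have "expo (dual_axis i) y \<noteq> 0"
    using norm_expo[of "dual_axis i" y] by (metis norm_zero zero_neq_one)
  ultimately have "expo (dual_axis i) (x - y) = 1"
    using expo_add_right[of "dual_axis i" "x - y" y] by (metis diff_add_cancel mult_cancel_right1)
  then have "\<exists>n::int. Im (2 * of_real pi * \<i> * of_real (dual_axis i \<bullet> (x - y))) = of_int (2 * n) * pi"
    unfolding expo_def exp_eq_1 by (rule conjunct2)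
  then obtain n :: int where "Im (2 * of_real pi * \<i> * of_real (dual_axis i \<bullet> (x - y))) = of_int (2 * n) * pi" ..
  then have "2 * pi * (dual_axis i \<bullet> (x - y)) = 2 * pi * of_int n" by simp
  then have "dual_axis i \<bullet> (x - y) = of_int n" by simp
  then have "coords x $ i - coords y $ i = of_int n"
    by (simp add: dual_axis_inner coords_diff)
  then show ?thesis by simp
qed

text \<open>Euler's formulas. The approximation theorem concerns rings of real functions, so points
  of the torus are separated by real and imaginary parts of coordinates.\<close>

lemma trig_poly_Re_torus: "trig_poly (\<lambda>x. of_real (Re (torus_map x $ i)))"
  and trig_poly_Im_torus: "trig_poly (\<lambda>x. of_real (Im (torus_map x $ i)))"
proof -
  let ?l = "dual_axis i"
  have l: "?l \<in> dual_lattice M" "- ?l \<in> dual_lattice M"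
    using dual_axis_in_dual_lattice dual_lattice_uminus by auto
  have "trig_poly (\<lambda>x. (1 / 2) * expo ?l x + (1 / 2) * expo (- ?l) x)"
    by (intro trig_poly_add trig_poly_expo l)
  moreover have "(1 / 2) * expo ?l x + (1 / 2) * expo (- ?l) x = of_real (Re (torus_map x $ i))" for x
    by (simp add: torus_map_def cnj_expo[symmetric] complex_eq_iff)
  ultimately show "trig_poly (\<lambda>x. of_real (Re (torus_map x $ i)))" by simp
  have "trig_poly (\<lambda>x. (- \<i> / 2) * expo ?l x + (\<i> / 2) * expo (- ?l) x)"
    by (intro trig_poly_add trig_poly_expo l)
  moreover have "(- \<i> / 2) * expo ?l x + (\<i> / 2) * expo (- ?l) x = of_real (Im (torus_map x $ i))" for x
    by (simp add: torus_map_def cnj_expo[symmetric] complex_eq_iff)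
  ultimately show "trig_poly (\<lambda>x. of_real (Im (torus_map x $ i)))" by simp
qed

text \<open>Unlike the half-open cell it is compact, at the price that \<open>torus_map\<close>
  identifies its opposite faces.\<close>

definition closed_cell :: "(real^'d) set" where
  "closed_cell = {x. \<forall>i. 0 \<le> coords x $ i \<and> coords x $ i \<le> 1}"

lemma cell_subset_closed_cell: "Cell \<subseteq> closed_cell"
  by (auto simp: cell_iff closed_cell_def less_imp_le)

lemma compact_closed_cell: "compact closed_cell"
proof -
  have "closed_cell = (*v) M ` cbox 0 1"
  proof (intro equalityI subsetI)
    fix x assume "x \<in> closed_cell"
    then show "x \<in> (*v) M ` cbox 0 1"
      by (intro image_eqI[of _ _ "coords x"]) (auto simp: closed_cell_def mem_box_cart)
  qed (auto simp: closed_cell_def mem_box_cart)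
  then show ?thesis
    by (simp add: compact_continuous_image linear_continuous_on matrix_vector_mul_bounded_linear)
qed

lemma range_torus_map: "range torus_map = torus_map ` closed_cell"
proof -
  have "torus_map x = torus_map (reduce x)" for x
    by (simp add: torus_map_def expo_reduce dual_axis_in_dual_lattice)
  then show ?thesis using reduce_in_cell cell_subset_closed_cell by blast
qed

lemma compact_torus: "compact (range torus_map)"
  unfolding range_torus_map
  by (intro compact_continuous_image continuous_torus_map compact_closed_cell)

text \<open>A continuous function vanishing on the boundary of the cell descends to the torus, where the
  trigonometric polynomials satisfy the hypotheses of the Stone-Weierstrass theorem.\<close>
lemma trig_poly_uniform_approx:
  fixes h :: "real^'d \<Rightarrow> real"
  assumes h: "continuous_on closed_cell h"
    and h0: "\<And>x i. x \<in> closed_cell \<Longrightarrow> coords x $ i \<in> {0, 1} \<Longrightarrow> h x = 0" and "0 < \<epsilon>"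
  shows "\<exists>p. trig_poly p \<and> (\<forall>x\<in>Cell. cmod (of_real (h x) - p x) < \<epsilon>)"
proof -
  let ?T = "range torus_map"
  \<comment> \<open>The function induced by h on the torus; the choice of a preimage is harmless by
    \<open>h_eq\<close>.\<close>
  define H where "H w = h (SOME x. x \<in> closed_cell \<and> torus_map x = w)" for w
  have h_eq: "h x = h y" if xy: "x \<in> closed_cell" "y \<in> closed_cell" "torus_map x = torus_map y" for x y
  proof (cases "x = y")
    case False
    then obtain i where i: "coords x $ i \<noteq> coords y $ i"
      by (metis M_coords vec_eq_iff)
    obtain n where n: "coords x $ i - coords y $ i = of_int n"
      using torus_map_eq_imp[OF xy(3), of i] by (elim Ints_cases)
    have b: "0 \<le> coords x $ i" "coords x $ i \<le> 1" "0 \<le> coords y $ i" "coords y $ i \<le> 1"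
      using xy by (auto simp: closed_cell_def)
    \<comment> \<open>Two coordinates in [0, 1] that differ by a nonzero integer are 0 and 1, so
      both points lie on the boundary, where h vanishes.\<close>
    have "n \<noteq> 0" "real_of_int n \<le> 1" "- 1 \<le> real_of_int n" using n b i by linarith+
    then have "n = 1 \<or> n = - 1" by linarith
    then have "coords x $ i \<in> {0, 1}" "coords y $ i \<in> {0, 1}" using n b by auto
    then show ?thesis using h0 xy by metis
  qed simp
  have H: "H (torus_map x) = h x" if "x \<in> closed_cell" for x
  proof -
    have "(SOME y. y \<in> closed_cell \<and> torus_map y = torus_map x) \<in> closed_cell \<and>
        torus_map (SOME y. y \<in> closed_cell \<and> torus_map y = torus_map x) = torus_map x"
      by (rule someI[of _ x]) (use that in simp)
    then show ?thesis unfolding H_def using h_eq that by blast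
  qed
  \<comment> \<open>H is continuous because \<open>torus_map\<close> on the compact
    \<open>closed_cell\<close> is a closed map: preimages under H are images of compact
    sets.\<close>
  have contH: "continuous_on ?T H"
    unfolding continuous_on_closed_vimage[OF compact_imp_closed[OF compact_torus]]
  proof (intro allI impI)
    fix B :: "real set" assume "closed B"
    have "closed (h -` B \<inter> closed_cell)"
      using h \<open>closed B\<close>
      unfolding continuous_on_closed_vimage[OF compact_imp_closed[OF compact_closed_cell]] by simp
    then have "compact (closed_cell \<inter> (h -` B \<inter> closed_cell))"
      by (intro compact_Int_closed compact_closed_cell)
    then have "compact (torus_map ` (closed_cell \<inter> (h -` B \<inter> closed_cell)))"
      by (intro compact_continuous_image continuous_torus_map)
    moreover have "H -` B \<inter> ?T = torus_map ` (closed_cell \<inter> (h -` B \<inter> closed_cell))"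
      unfolding range_torus_map
    proof (intro equalityI subsetI)
      fix w assume "w \<in> H -` B \<inter> torus_map ` closed_cell"
      then obtain x where "w = torus_map x" "x \<in> closed_cell" "H w \<in> B" by blast
      then show "w \<in> torus_map ` (closed_cell \<inter> (h -` B \<inter> closed_cell))"
        by (intro image_eqI[of _ _ x]) (simp_all add: H)
    next
      fix w assume "w \<in> torus_map ` (closed_cell \<inter> (h -` B \<inter> closed_cell))"
      then obtain x where "w = torus_map x" "x \<in> closed_cell" "h x \<in> B" by blast
      then show "w \<in> H -` B \<inter> torus_map ` closed_cell" by (simp add: H)
    qed
    ultimately show "closed (H -` B \<inter> ?T)" by (simp add: compact_imp_closed)
  qed
  define R where "R = {f. continuous_on ?T f \<and> trig_poly (\<lambda>x. of_real (f (torus_map x)))}"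
  interpret function_ring_on R ?T
  proof
    fix w z assume wz: "w \<in> ?T" "z \<in> ?T" "w \<noteq> z"
    from wz(3) obtain i where "w $ i \<noteq> z $ i"
      unfolding vec_eq_iff by blast
    then have i: "Re (w $ i) \<noteq> Re (z $ i) \<or> Im (w $ i) \<noteq> Im (z $ i)"
      unfolding complex_eq_iff by blast
    have ReIm: "(\<lambda>w. Re (w $ i)) \<in> R" "(\<lambda>w. Im (w $ i)) \<in> R"
      unfolding R_def
      by (simp_all add: trig_poly_Re_torus trig_poly_Im_torus continuous_on_Re continuous_on_Im
          continuous_on_component continuous_on_id)
    from i show "\<exists>f\<in>R. f w \<noteq> f z"
    proof
      assume "Re (w $ i) \<noteq> Re (z $ i)"
      then show ?thesis using ReIm(1) by (rule bexI)
    next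
      assume "Im (w $ i) \<noteq> Im (z $ i)"
      then show ?thesis using ReIm(2) by (rule bexI)
    qed
  next
    fix c :: real
    show "(\<lambda>_. c) \<in> R" by (simp add: R_def trig_poly_const)
  next
    fix f g assume "f \<in> R" "g \<in> R"
    then have c: "continuous_on ?T f" "continuous_on ?T g"
      and t: "trig_poly (\<lambda>x. of_real (f (torus_map x)))" "trig_poly (\<lambda>x. of_real (g (torus_map x)))"
      by (simp_all add: R_def)
    show "(\<lambda>x. f x + g x) \<in> R" "(\<lambda>x. f x * g x) \<in> R"
      using trig_poly_add[OF t] trig_poly_mult[OF t] continuous_on_add[OF c] continuous_on_mult[OF c]
      by (simp_all add: R_def)
  qed (auto simp: compact_torus R_def)
  obtain g where g: "g \<in> R" "\<forall>w\<in>?T. \<bar>H w - g w\<bar> < \<epsilon>"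
    using Stone_Weierstrass_basic[OF contH \<open>0 < \<epsilon>\<close>] by blast
  have "cmod (of_real (h x) - of_real (g (torus_map x))) < \<epsilon>" if "x \<in> Cell" for x
  proof -
    have "cmod (of_real (h x) - of_real (g (torus_map x))) = \<bar>H (torus_map x) - g (torus_map x)\<bar>"
      using H[of x] that cell_subset_closed_cell by (auto simp flip: of_real_diff)
    then show ?thesis using g(2) by simp
  qed
  then show ?thesis using g(1) unfolding R_def by blast
qed

section \<open>Density of trigonometric polynomials in L2 of the cell\<close>

abbreviation "cell_measure \<equiv> lebesgue_on Cell"

lemma finite_cell_measure: "finite_measure cell_measure"
  by (rule finite_measure_lebesgue_on[OF lmeasurable_cell])

lemma space_cell_measure: "space cell_measure = Cell"
  by (simp add: space_restrict_space)

lemma L2_fun_cell_bounded: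
  assumes "f \<in> borel_measurable cell_measure" "AE x in cell_measure. cmod (f x) \<le> B"
  shows "f \<in> L2_fun cell_measure"
proof (rule L2_fun_dominated[OF assms(1)])
  interpret finite_measure cell_measure by (rule finite_cell_measure)
  show "integrable cell_measure (\<lambda>x. B\<^sup>2)" by simp
  show "AE x in cell_measure. (cmod (f x))\<^sup>2 \<le> B\<^sup>2"
    using assms(2) by (auto elim!: eventually_mono intro: power_mono)
qed

lemma expo_L2_cell: "expo l \<in> L2_fun cell_measure"
  by (rule L2_fun_cell_bounded[where B = 1]) (auto intro: borel_measurable_expo)

lemma trig_poly_L2: "trig_poly p \<Longrightarrow> p \<in> L2_fun cell_measure"
proof (induction rule: trig_poly.induct)
  case trig_poly_zero
  show ?case by (rule L2_fun_cell_bounded[where B = 0]) auto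
qed (intro L2_fun_add L2_fun_cmult expo_L2_cell)

definition trig_approx :: "(real^'d \<Rightarrow> complex) \<Rightarrow> bool" where
  "trig_approx f \<longleftrightarrow> f \<in> L2_fun cell_measure \<and>
     (\<forall>\<epsilon>>0. \<exists>p. trig_poly p \<and> (LINT x|cell_measure. (cmod (f x - p x))\<^sup>2) < \<epsilon>)"

lemma L2_dist_triangle:
  assumes "f \<in> L2_fun N" "g \<in> L2_fun N" "h \<in> L2_fun N"
  shows "(LINT x|N. (cmod (f x - h x))\<^sup>2) \<le>
    2 * (LINT x|N. (cmod (f x - g x))\<^sup>2) + 2 * (LINT x|N. (cmod (g x - h x))\<^sup>2)"
proof -
  have i: "integrable N (\<lambda>x. (cmod (f x - g x))\<^sup>2)" "integrable N (\<lambda>x. (cmod (g x - h x))\<^sup>2)"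
    "integrable N (\<lambda>x. (cmod (f x - h x))\<^sup>2)"
    using assms by (auto intro!: L2_fun_integrable L2_fun_diff)
  have "(LINT x|N. (cmod (f x - h x))\<^sup>2) \<le>
      (LINT x|N. 2 * (cmod (f x - g x))\<^sup>2 + 2 * (cmod (g x - h x))\<^sup>2)"
    using i cmod_add_square_le[of "f x - g x" "g x - h x" for x]
    by (intro integral_mono) auto
  then show ?thesis using i by simp
qed

lemma trig_approx_closed:
  assumes f: "f \<in> L2_fun cell_measure"
    and "\<And>\<epsilon>. 0 < \<epsilon> \<Longrightarrow> \<exists>g. trig_approx g \<and> (LINT x|cell_measure. (cmod (f x - g x))\<^sup>2) < \<epsilon>"
  shows "trig_approx f"
  unfolding trig_approx_def
proof (intro conjI allI impI)
  fix \<epsilon> :: real assume "0 < \<epsilon>"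
  \<comment> \<open>Squared distances satisfy the triangle inequality only with a factor 2, and 2
    (\<epsilon>/4) + 2 (\<epsilon>/4) = \<epsilon>.\<close>
  then have e: "0 < \<epsilon> / 4" by simp
  obtain g where g: "trig_approx g" "(LINT x|cell_measure. (cmod (f x - g x))\<^sup>2) < \<epsilon> / 4"
    using assms(2)[OF e] by blast
  obtain p where p: "trig_poly p" "(LINT x|cell_measure. (cmod (g x - p x))\<^sup>2) < \<epsilon> / 4"
    using g(1) e unfolding trig_approx_def by blast
  have "(LINT x|cell_measure. (cmod (f x - p x))\<^sup>2) < \<epsilon>"
    using L2_dist_triangle[OF f, of g p] g p trig_poly_L2 unfolding trig_approx_def by fastforce
  then show "\<exists>p. trig_poly p \<and> (LINT x|cell_measure. (cmod (f x - p x))\<^sup>2) < \<epsilon>" using p(1) by blast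
qed (rule f)

lemma trig_approx_limit:
  assumes f: "f \<in> L2_fun cell_measure" and g: "\<And>n. trig_approx (g n)"
    and lim: "AE x in cell_measure. (\<lambda>n. g n x) \<longlonglongrightarrow> f x"
    and bd: "integrable cell_measure b" "\<And>n. AE x in cell_measure. (cmod (f x - g n x))\<^sup>2 \<le> b x"
  shows "trig_approx f"
proof (rule trig_approx_closed[OF f])
  fix \<epsilon> :: real assume \<epsilon>: "0 < \<epsilon>"
  have gL: "g n \<in> L2_fun cell_measure" for n using g by (simp add: trig_approx_def)
  have "(\<lambda>n. LINT x|cell_measure. (cmod (f x - g n x))\<^sup>2) \<longlonglongrightarrow> (LINT x|cell_measure. 0)"
  proof (rule integral_dominated_convergence[where w = b])
    show "AE x in cell_measure. (\<lambda>n. (cmod (f x - g n x))\<^sup>2) \<longlonglongrightarrow> 0"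
      using lim
    proof eventually_elim
      case (elim x)
      then have "(\<lambda>n. (cmod (f x - g n x))\<^sup>2) \<longlonglongrightarrow> (cmod (f x - f x))\<^sup>2"
        by (intro tendsto_intros)
      then show ?case by simp
    qed
    show "(\<lambda>x. (cmod (f x - g n x))\<^sup>2) \<in> borel_measurable cell_measure" for n
      using L2_fun_integrable[OF L2_fun_diff[OF f gL]] by (rule borel_measurable_integrable)
  qed (use bd in auto)
  then have "\<forall>\<^sub>F n in sequentially. (LINT x|cell_measure. (cmod (f x - g n x))\<^sup>2) < \<epsilon>"
    using \<epsilon> by (intro order_tendstoD) auto
  then obtain n where "(LINT x|cell_measure. (cmod (f x - g n x))\<^sup>2) < \<epsilon>"
    by (auto simp: eventually_sequentially)
  then show "\<exists>g. trig_approx g \<and> (LINT x|cell_measure. (cmod (f x - g x))\<^sup>2) < \<epsilon>" using g by blast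
qed

lemma trig_approx_continuous:
  fixes h :: "real^'d \<Rightarrow> real"
  assumes h: "continuous_on closed_cell h"
    and h0: "\<And>x i. x \<in> closed_cell \<Longrightarrow> coords x $ i \<in> {0, 1} \<Longrightarrow> h x = 0"
    and L2: "(\<lambda>x. complex_of_real (h x)) \<in> L2_fun cell_measure"
  shows "trig_approx (\<lambda>x. complex_of_real (h x))"
  unfolding trig_approx_def
proof (intro conjI allI impI L2)
  interpret finite_measure cell_measure by (rule finite_cell_measure)
  fix \<epsilon> :: real assume \<epsilon>: "0 < \<epsilon>"
  define m where "m = measure lebesgue Cell"
  have m: "m = measure cell_measure Cell" "0 < m"
    using sets_cell measure_cell_pos by (simp_all add: m_def measure_restrict_space)
  \<comment> \<open>Chosen so that a uniform error \<delta> on a cell of volume m has squared L2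
    norm at most \<epsilon>/2, strictly below \<epsilon>.\<close>
  define \<delta> where "\<delta> = sqrt (\<epsilon> / (2 * m))"
  have \<delta>: "0 < \<delta>" "\<delta>\<^sup>2 * m = \<epsilon> / 2" using \<epsilon> m by (simp_all add: \<delta>_def)
  have "\<exists>p. trig_poly p \<and> (\<forall>x\<in>Cell. cmod (of_real (h x) - p x) < \<delta>)"
    by (rule trig_poly_uniform_approx[OF h _ \<delta>(1)]) (rule h0)
  then obtain p where p: "trig_poly p" "\<And>x. x \<in> Cell \<Longrightarrow> cmod (of_real (h x) - p x) < \<delta>"
    by blast
  have "(LINT x|cell_measure. (cmod (of_real (h x) - p x))\<^sup>2) \<le> (LINT x|cell_measure. \<delta>\<^sup>2)"
    using L2_fun_integrable[OF L2_fun_diff[OF L2 trig_poly_L2[OF p(1)]]] p(2)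
    by (intro integral_mono) (auto simp: space_cell_measure less_imp_le intro!: power_mono)
  also have "\<dots> = \<epsilon> / 2" using \<delta>(2) m by (simp add: space_cell_measure mult.commute)
  finally have "(LINT x|cell_measure. (cmod (of_real (h x) - p x))\<^sup>2) < \<epsilon>" using \<epsilon> by linarith
  then show "\<exists>p. trig_poly p \<and> (LINT x|cell_measure. (cmod (of_real (h x) - p x))\<^sup>2) < \<epsilon>"
    using p(1) by blast
qed

text \<open>Each factor vanishes on a pair of opposite faces and equals 1 for large n at any point
  strictly between them. Multiplying by it forces the boundary condition of
  \<open>trig_poly_uniform_approx\<close>.\<close>

definition cutoff :: "nat \<Rightarrow> real^'d \<Rightarrow> real" where
  "cutoff n x = (\<Prod>i\<in>UNIV. min 1 (real n * (coords x $ i * (1 - coords x $ i))))"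

lemma continuous_cutoff: "continuous_on S (cutoff n)"
  unfolding cutoff_def by (intro continuous_intros continuous_on_component continuous_coords)

lemma cutoff_bounds: "x \<in> closed_cell \<Longrightarrow> 0 \<le> cutoff n x" "x \<in> closed_cell \<Longrightarrow> cutoff n x \<le> 1"
  unfolding cutoff_def closed_cell_def by (auto intro!: prod_nonneg prod_le_1)

lemma cutoff_boundary: "coords x $ i \<in> {0, 1} \<Longrightarrow> cutoff n x = 0"
proof -
  assume "coords x $ i \<in> {0, 1}"
  then have "min 1 (real n * (coords x $ i * (1 - coords x $ i))) = 0" by auto
  then show ?thesis unfolding cutoff_def by (intro prod_zero bexI[of _ i]) simp_all
qed

lemma cutoff_tendsto:
  assumes "\<And>i. 0 < coords x $ i \<and> coords x $ i < 1"
  shows "(\<lambda>n. cutoff n x) \<longlonglongrightarrow> 1"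
proof -
  have "(\<lambda>n. min 1 (real n * c)) \<longlonglongrightarrow> 1" if "0 < c" for c :: real
  proof (rule tendsto_eventually)
    show "\<forall>\<^sub>F n in sequentially. min 1 (real n * c) = 1"
      using eventually_ge_at_top[of "nat \<lceil>1 / c\<rceil>"]
    proof eventually_elim
      case (elim n)
      then have "1 / c \<le> real n" by linarith
      then show ?case using that by (simp add: field_simps)
    qed
  qed
  then have "(\<lambda>n. cutoff n x) \<longlonglongrightarrow> (\<Prod>i\<in>(UNIV::'d set). 1)"
    unfolding cutoff_def using assms by (intro tendsto_prod) auto
  then show ?thesis by simp
qed

text \<open>The half-open cell contains only its lower faces, and these lie in finitely many
  hyperplanes through 0.\<close>

lemma AE_cell_interior: "AE x in cell_measure. x \<in> Cell \<and> (\<forall>i. 0 < coords x $ i \<and> coords x $ i < 1)"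
proof -
  have "AE x in lebesgue. x \<notin> {x. dual_axis i \<bullet> x = 0}" for i
    using negligible_hyperplane[of "dual_axis i" 0] dual_axis_nonzero
    by (intro AE_not_in) (simp add: negligible_iff_null_sets)
  then have "AE x in lebesgue. \<forall>i. coords x $ i \<noteq> 0"
    by (simp add: AE_all_countable dual_axis_inner)
  then have "AE x in lebesgue. x \<in> Cell \<longrightarrow> x \<in> Cell \<and> (\<forall>i. 0 < coords x $ i \<and> coords x $ i < 1)"
    by eventually_elim (auto simp: cell_iff less_le)
  then show ?thesis using sets_cell by (subst AE_restrict_space_iff) auto
qed

text \<open>A measurable function is almost everywhere a limit of continuous ones. Clipping these to
  [-B, B] supplies a dominating constant, and the cutoff makes them vanish on the boundary without
  changing the limit in the interior.\<close>

lemma trig_approx_bounded: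
  fixes f :: "real^'d \<Rightarrow> real"
  assumes f: "f \<in> borel_measurable cell_measure" and B: "\<And>x. \<bar>f x\<bar> \<le> B"
  shows "trig_approx (\<lambda>x. complex_of_real (f x))"
proof -
  interpret finite_measure cell_measure by (rule finite_cell_measure)
  have "f measurable_on Cell"
    using f by (simp add: measurable_on_iff_borel_measurable sets_cell)
  from this[unfolded measurable_on_def] obtain N g where N: "negligible N" and g: "\<And>n. continuous_on UNIV (g n)"
    and lim: "\<And>x. x \<notin> N \<Longrightarrow> (\<lambda>n. g n x) \<longlonglongrightarrow> (if x \<in> Cell then f x else 0)"
    by blast
  define h where "h n x = max (- B) (min B (g n x)) * cutoff n x" for n :: nat and x
  have hc: "continuous_on S (h n)" for n S
    unfolding h_def
    by (intro continuous_intros continuous_cutoff continuous_on_subset[OF g]) auto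
  have "0 \<le> B" using B[of 0] by linarith
  have hB: "\<bar>h n x\<bar> \<le> B" if "x \<in> Cell" for n x
  proof -
    have "\<bar>max (- B) (min B (g n x))\<bar> \<le> B" using \<open>0 \<le> B\<close> by auto
    moreover have "\<bar>cutoff n x\<bar> \<le> 1" using cutoff_bounds[of x n] that cell_subset_closed_cell by auto
    ultimately have "\<bar>max (- B) (min B (g n x))\<bar> * \<bar>cutoff n x\<bar> \<le> B * 1"
      using \<open>0 \<le> B\<close> by (intro mult_mono) auto
    then show ?thesis by (simp add: h_def abs_mult)
  qed
  have h_meas: "h n \<in> borel_measurable cell_measure" for n
    using hc by (intro measurable_restrict_space1 measurable_completion)
      (simp add: borel_measurable_continuous_onI)
  have AE_cell: "AE x in cell_measure. x \<in> Cell"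
    by (rule AE_I2) (simp add: space_cell_measure)
  show ?thesis
  proof (rule trig_approx_limit[where g = "\<lambda>n x. complex_of_real (h n x)" and b = "\<lambda>x. (2 * B)\<^sup>2"])
    show "(\<lambda>x. complex_of_real (f x)) \<in> L2_fun cell_measure"
      by (rule L2_fun_cell_bounded[where B = B]) (use f B in auto)
    show "trig_approx (\<lambda>x. complex_of_real (h n x))" for n
    proof (rule trig_approx_continuous)
      show "(\<lambda>x. complex_of_real (h n x)) \<in> L2_fun cell_measure"
      proof (rule L2_fun_cell_bounded[where B = B])
        show "(\<lambda>x. complex_of_real (h n x)) \<in> borel_measurable cell_measure"
          using h_meas by simp
        show "AE x in cell_measure. cmod (complex_of_real (h n x)) \<le> B"
          using AE_cell by eventually_elim (simp add: hB)
      qed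
      show "continuous_on closed_cell (h n)" by (rule hc)
      show "h n x = 0" if "coords x $ i \<in> {0, 1}" for x i
        unfolding h_def using cutoff_boundary[OF that] by simp
    qed
    show "AE x in cell_measure. (cmod (complex_of_real (f x) - complex_of_real (h n x)))\<^sup>2 \<le> (2 * B)\<^sup>2" for n
      using AE_cell
    proof eventually_elim
      case (elim x)
      have "cmod (complex_of_real (f x) - complex_of_real (h n x)) = \<bar>f x - h n x\<bar>"
        by (metis norm_of_real of_real_diff)
      also have "\<dots> \<le> 2 * B" using B[of x] hB[OF elim, of n] by linarith
      finally show ?case by (intro power_mono) auto
    qed
    have "AE x in lebesgue. x \<notin> N"
      using N by (intro AE_not_in) (simp add: negligible_iff_null_sets)
    then have "AE x in cell_measure. x \<notin> N"
      using sets_cell by (subst AE_restrict_space_iff) (auto elim: eventually_mono)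
    then show "AE x in cell_measure. (\<lambda>n. complex_of_real (h n x)) \<longlonglongrightarrow> complex_of_real (f x)"
      using AE_cell_interior
    proof eventually_elim
      case (elim x)
      have "(\<lambda>n. h n x) \<longlonglongrightarrow> max (- B) (min B (f x)) * 1"
        unfolding h_def using lim[OF elim(1)] elim(2)
        by (intro tendsto_intros cutoff_tendsto) auto
      moreover have "max (- B) (min B (f x)) = f x" using B[of x] by auto
      ultimately show ?case by (intro tendsto_of_real) simp
    qed
  qed simp
qed

text \<open>Truncation at height n moves values towards 0, so the squared error is dominated by the
  square of f itself.\<close>

lemma trig_approx_real:
  fixes f :: "real^'d \<Rightarrow> real"
  assumes f: "(\<lambda>x. complex_of_real (f x)) \<in> L2_fun cell_measure"
  shows "trig_approx (\<lambda>x. complex_of_real (f x))"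
proof -
  have meas: "f \<in> borel_measurable cell_measure"
    using measurable_compose[OF L2_fun_measurable[OF f] borel_measurable_Re] by simp
  define g where "g n x = max (- real n) (min (real n) (f x))" for n :: nat and x
  show ?thesis
  proof (rule trig_approx_limit[where g = "\<lambda>n x. complex_of_real (g n x)" and b = "\<lambda>x. (f x)\<^sup>2"])
    show "trig_approx (\<lambda>x. complex_of_real (g n x))" for n
      by (rule trig_approx_bounded[where B = "real n"]) (use meas in \<open>auto simp: g_def\<close>)
    show "integrable cell_measure (\<lambda>x. (f x)\<^sup>2)"
      using L2_fun_integrable[OF f] by simp
    have "(cmod (complex_of_real (f x) - complex_of_real (g n x)))\<^sup>2 \<le> (f x)\<^sup>2" for n x
    proof -
      have "cmod (complex_of_real (f x) - complex_of_real (g n x)) = \<bar>f x - g n x\<bar>"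
        by (metis norm_of_real of_real_diff)
      also have "\<dots> \<le> \<bar>f x\<bar>" by (auto simp: g_def)
      finally have "(cmod (complex_of_real (f x) - complex_of_real (g n x)))\<^sup>2 \<le> \<bar>f x\<bar>\<^sup>2"
        by (intro power_mono) auto
      then show ?thesis by simp
    qed
    then show "AE x in cell_measure. (cmod (complex_of_real (f x) - complex_of_real (g n x)))\<^sup>2 \<le> (f x)\<^sup>2" for n
      by simp
    have "(\<lambda>n. g n x) \<longlonglongrightarrow> f x" for x
    proof (rule tendsto_eventually)
      show "\<forall>\<^sub>F n in sequentially. g n x = f x"
        using eventually_ge_at_top[of "nat \<lceil>\<bar>f x\<bar>\<rceil>"]
      proof eventually_elim
        case (elim n)
        then have "\<bar>f x\<bar> \<le> real n" by linarith
        then show ?case by (auto simp: g_def)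
      qed
    qed
    then show "AE x in cell_measure. (\<lambda>n. complex_of_real (g n x)) \<longlonglongrightarrow> complex_of_real (f x)"
      by (intro AE_I2 tendsto_of_real)
  qed (rule f)
qed

lemma trig_approx_L2:
  assumes f: "f \<in> L2_fun cell_measure"
  shows "trig_approx f"
proof -
  have part: "(\<lambda>x. complex_of_real (u (f x))) \<in> L2_fun cell_measure"
    if "u \<in> borel_measurable borel" "\<And>z. \<bar>u z\<bar> \<le> cmod z" for u
  proof (rule L2_fun_dominated[OF _ L2_fun_integrable[OF f]])
    show "(\<lambda>x. complex_of_real (u (f x))) \<in> borel_measurable cell_measure"
      using measurable_compose[OF L2_fun_measurable[OF f] that(1)] by simp
    show "AE x in cell_measure. (cmod (complex_of_real (u (f x))))\<^sup>2 \<le> (cmod (f x))\<^sup>2"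
    proof (rule AE_I2)
      fix x
      have "\<bar>u (f x)\<bar>\<^sup>2 \<le> (cmod (f x))\<^sup>2" using that(2) by (intro power_mono) auto
      then show "(cmod (complex_of_real (u (f x))))\<^sup>2 \<le> (cmod (f x))\<^sup>2" by simp
    qed
  qed
  have Re: "(\<lambda>x. complex_of_real (Re (f x))) \<in> L2_fun cell_measure"
    and Im: "(\<lambda>x. complex_of_real (Im (f x))) \<in> L2_fun cell_measure"
    by (auto intro!: part abs_Re_le_cmod abs_Im_le_cmod)
  show ?thesis
    unfolding trig_approx_def
  proof (intro conjI allI impI f)
    fix \<epsilon> :: real assume "0 < \<epsilon>"
    then have e: "0 < \<epsilon> / 4" by simp
    obtain p where p: "trig_poly p" "(LINT x|cell_measure. (cmod (of_real (Re (f x)) - p x))\<^sup>2) < \<epsilon> / 4"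
      using trig_approx_real[OF Re] e unfolding trig_approx_def by blast
    obtain q where q: "trig_poly q" "(LINT x|cell_measure. (cmod (of_real (Im (f x)) - q x))\<^sup>2) < \<epsilon> / 4"
      using trig_approx_real[OF Im] e unfolding trig_approx_def by blast
    have pq: "trig_poly (\<lambda>x. p x + \<i> * q x)"
      using p(1) q(1) by (intro trig_poly_add trig_poly_cmult)
    have "(LINT x|cell_measure. (cmod (f x - (p x + \<i> * q x)))\<^sup>2) \<le>
       (LINT x|cell_measure. 2 * (cmod (of_real (Re (f x)) - p x))\<^sup>2 + 2 * (cmod (of_real (Im (f x)) - q x))\<^sup>2)"
    proof (rule integral_mono)
      show "integrable cell_measure (\<lambda>x. (cmod (f x - (p x + \<i> * q x)))\<^sup>2)"
        by (intro L2_fun_integrable L2_fun_diff f trig_poly_L2 pq)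
      show "integrable cell_measure (\<lambda>x. 2 * (cmod (of_real (Re (f x)) - p x))\<^sup>2 +
          2 * (cmod (of_real (Im (f x)) - q x))\<^sup>2)"
        using L2_fun_integrable[OF L2_fun_diff[OF Re trig_poly_L2[OF p(1)]]]
          L2_fun_integrable[OF L2_fun_diff[OF Im trig_poly_L2[OF q(1)]]] by simp
      fix x
      have eq: "f x - (p x + \<i> * q x) = (of_real (Re (f x)) - p x) + \<i> * (of_real (Im (f x)) - q x)"
        by (subst complex_eq[of "f x"]) (simp add: algebra_simps)
      show "(cmod (f x - (p x + \<i> * q x)))\<^sup>2 \<le>
          2 * (cmod (of_real (Re (f x)) - p x))\<^sup>2 + 2 * (cmod (of_real (Im (f x)) - q x))\<^sup>2"
        unfolding eq
        using cmod_add_square_le[of "of_real (Re (f x)) - p x" "\<i> * (of_real (Im (f x)) - q x)"]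
        by (simp add: norm_mult)
    qed
    also have "\<dots> < \<epsilon>"
      using p q L2_fun_integrable[OF L2_fun_diff[OF Re trig_poly_L2[OF p(1)]]]
        L2_fun_integrable[OF L2_fun_diff[OF Im trig_poly_L2[OF q(1)]]] by simp
    finally show "\<exists>p. trig_poly p \<and> (LINT x|cell_measure. (cmod (f x - p x))\<^sup>2) < \<epsilon>"
      using pq by blast
  qed
qed

lemma orthogonal_basis_expo:
  "orthogonal_basis cell_measure (dual_lattice M) expo (measure lebesgue Cell)"
proof
  show "0 < measure lebesgue Cell" by (rule measure_cell_pos)
  show "expo l \<in> L2_fun cell_measure" for l by (rule expo_L2_cell)
next
  fix l l' assume l: "l \<in> dual_lattice M" "l' \<in> dual_lattice M"
  have "L2_inner_on cell_measure (expo l) (expo l') = (LINT x|cell_measure. expo (l - l') x)"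
    by (simp add: L2_inner_on_def cnj_expo expo_add_left[symmetric])
  also have "\<dots> = (if l = l' then of_real (measure lebesgue Cell) else 0)"
    using integral_expo_cell[of "l - l'"] dual_lattice_add[OF l(1) dual_lattice_uminus[OF l(2)]] sets_cell
    by (auto simp: expo_zero measure_restrict_space scaleR_conv_of_real space_cell_measure)
  finally show "L2_inner_on cell_measure (expo l) (expo l') =
      (if l = l' then of_real (measure lebesgue Cell) else 0)" .
next
  fix f :: "real^'d \<Rightarrow> complex" and \<epsilon> :: real
  assume f: "f \<in> L2_fun cell_measure" and "0 < \<epsilon>"
  then obtain p where "trig_poly p" "(LINT x|cell_measure. (cmod (f x - p x))\<^sup>2) < \<epsilon>"
    using trig_approx_L2[OF f] unfolding trig_approx_def by blast
  then show "\<exists>F c. finite F \<and> F \<subseteq> dual_lattice M \<and>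
      (LINT x|cell_measure. (cmod (f x - (\<Sum>l\<in>F. c l * expo l x)))\<^sup>2) < \<epsilon>"
    using trig_poly_sum[of p] by blast
qed

end

section \<open>Multi-tiles\<close>

locale multi_tile = real_lattice M
  for M :: "real^'d^'d" +
  fixes \<Omega> E :: "(real^'d) set" and \<Omega>s :: "'k::finite \<Rightarrow> (real^'d) set"
  assumes lmeasurable: "\<Omega> \<in> lmeasurable"
    and partition: "\<Omega> = (\<Union>r. \<Omega>s r) \<union> E"
    and disjoint: "disjoint_family \<Omega>s"
    and null: "E \<in> null_sets lebesgue"
    and domains: "\<And>r. fundamental_domain \<Lambda> (\<Omega>s r)"
begin

abbreviation tile_measure where "tile_measure \<equiv> lebesgue_on \<Omega>"

lemma sets_tile: "\<Omega> \<in> sets lebesgue" "\<Omega>s r \<in> sets lebesgue"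
  using lmeasurable sets_D[OF domains] by auto

lemma tile_part_subset: "\<Omega>s r \<subseteq> \<Omega>"
  using partition by blast

lemma finite_tile_measure: "finite_measure tile_measure"
  by (rule finite_measure_lebesgue_on[OF lmeasurable])

lemma AE_tile_iff: "(AE x in tile_measure. Q x) \<longleftrightarrow> (\<forall>r. AE x in lebesgue_on (\<Omega>s r). Q x)"
proof
  assume "AE x in tile_measure. Q x"
  then show "\<forall>r. AE x in lebesgue_on (\<Omega>s r). Q x"
    using sets_tile tile_part_subset by (auto simp: AE_restrict_space_iff elim!: eventually_mono)
next
  assume "\<forall>r. AE x in lebesgue_on (\<Omega>s r). Q x"
  then have "AE x in lebesgue. \<forall>r. x \<in> \<Omega>s r \<longrightarrow> Q x"
    using sets_tile by (subst AE_all_countable) (simp add: AE_restrict_space_iff)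
  moreover have "AE x in lebesgue. x \<notin> E" using null by (rule AE_not_in)
  ultimately have "AE x in lebesgue. x \<in> \<Omega> \<longrightarrow> Q x"
    by eventually_elim (auto simp: partition)
  then show "AE x in tile_measure. Q x" using sets_tile by (simp add: AE_restrict_space_iff)
qed

text \<open>Measure-preserving maps pull null sets back to null sets. This lemma and
  \<open>AE_domain_section\<close> carry statements between the cell and a part of the tile in both
  directions.\<close>

lemma AE_tile_part_reduce:
  assumes "AE y in cell_measure. Q y"
  shows "AE x in lebesgue_on (\<Omega>s r). Q (reduce x)"
  by (rule AE_distrD[OF measurable_reduce[OF domains]]) (unfold distr_reduce[OF domains], rule assms)

lemma AE_domain_section:
  assumes "AE x in lebesgue_on (\<Omega>s r). Q x"
  shows "AE y in cell_measure. Q (domain_section (\<Omega>s r) y)"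
  by (rule AE_distrD[OF measurable_domain_section[OF domains]])
    (unfold distr_domain_section[OF domains], rule assms)

lemma measurable_section_tile: "domain_section (\<Omega>s r) \<in> measurable cell_measure tile_measure"
proof -
  have "(\<lambda>x. x) \<in> measurable (lebesgue_on (\<Omega>s r)) tile_measure"
    using tile_part_subset by (intro measurable_restrict_space3) auto
  from measurable_compose[OF measurable_domain_section[OF domains] this] show ?thesis by simp
qed

text \<open>Up to the null set E the tile is the disjoint union of its parts, and each part carries
  the image of the measure of the cell under its section.\<close>

lemma integral_tile:
  fixes f :: "real^'d \<Rightarrow> 'b::{banach, second_countable_topology}"
  assumes f: "integrable tile_measure f"
  shows "integrable cell_measure (\<lambda>y. f (domain_section (\<Omega>s r) y))"
    and "(LINT x|tile_measure. f x) = (\<Sum>r\<in>UNIV. LINT y|cell_measure. f (domain_section (\<Omega>s r) y))"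
proof -
  have int: "integrable lebesgue (\<lambda>x. indicator \<Omega> x *\<^sub>R f x)"
    using f sets_tile by (simp add: integrable_restrict_space)
  have int_part: "integrable lebesgue (\<lambda>x. indicator (\<Omega>s r) x *\<^sub>R f x)" for r
  proof -
    have "integrable lebesgue (\<lambda>x. indicator (\<Omega>s r) x *\<^sub>R (indicator \<Omega> x *\<^sub>R f x))"
      by (rule integrable_mult_indicator[OF sets_tile(2) int])
    moreover have "(\<lambda>x. indicator (\<Omega>s r) x *\<^sub>R (indicator \<Omega> x *\<^sub>R f x)) = (\<lambda>x. indicator (\<Omega>s r) x *\<^sub>R f x)"
    proof
      fix x
      show "indicator (\<Omega>s r) x *\<^sub>R (indicator \<Omega> x *\<^sub>R f x) = indicator (\<Omega>s r) x *\<^sub>R f x"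
        using tile_part_subset[of r] by (cases "x \<in> \<Omega>s r") auto
    qed
    ultimately show ?thesis by (simp only:)
  qed
  then have part: "integrable (lebesgue_on (\<Omega>s r)) f" for r
    using sets_tile by (simp add: integrable_restrict_space)
  show "integrable cell_measure (\<lambda>y. f (domain_section (\<Omega>s r) y))"
    using part
    by (intro integrable_distr[OF measurable_domain_section[OF domains]]) (simp add: distr_domain_section[OF domains])
  have part_eq: "(LINT y|cell_measure. f (domain_section (\<Omega>s r) y)) = (LINT x|lebesgue. indicator (\<Omega>s r) x *\<^sub>R f x)" for r
  proof -
    have "(LINT y|cell_measure. f (domain_section (\<Omega>s r) y)) =
        (LINT x|distr cell_measure (lebesgue_on (\<Omega>s r)) (domain_section (\<Omega>s r)). f x)"
      using part by (intro integral_distr[symmetric] measurable_domain_section domains) auto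
    also have "\<dots> = (LINT x|lebesgue. indicator (\<Omega>s r) x *\<^sub>R f x)"
      using sets_tile by (simp add: distr_domain_section[OF domains] integral_restrict_space)
    finally show ?thesis .
  qed
  have "(LINT x|tile_measure. f x) = (LINT x|lebesgue. indicator \<Omega> x *\<^sub>R f x)"
    using sets_tile by (simp add: integral_restrict_space)
  also have "\<dots> = (LINT x|lebesgue. (\<Sum>r\<in>UNIV. indicator (\<Omega>s r) x *\<^sub>R f x))"
  proof (rule integral_cong_AE)
    have "AE x in lebesgue. x \<notin> E" using null by (rule AE_not_in)
    then show "AE x in lebesgue. indicator \<Omega> x *\<^sub>R f x = (\<Sum>r\<in>UNIV. indicator (\<Omega>s r) x *\<^sub>R f x)"
    proof eventually_elim
      case (elim x)
      show ?case
      proof (cases "x \<in> \<Omega>")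
        case True
        then obtain q where q: "x \<in> \<Omega>s q" using elim partition by blast
        then have "indicator (\<Omega>s r) x *\<^sub>R f x = (if r = q then f x else 0)" for r
          using disjoint by (auto simp: disjoint_family_on_def indicator_def)
        then show ?thesis using True by simp
      next
        case False
        then have "x \<notin> \<Omega>s r" for r using tile_part_subset by blast
        then show ?thesis using False by simp
      qed
    qed
  qed (intro borel_measurable_integrable int Bochner_Integration.integrable_sum int_part)+
  also have "\<dots> = (\<Sum>r\<in>UNIV. LINT y|cell_measure. f (domain_section (\<Omega>s r) y))"
    unfolding part_eq by (rule Bochner_Integration.integral_sum) (rule int_part)
  finally show "(LINT x|tile_measure. f x) =
      (\<Sum>r\<in>UNIV. LINT y|cell_measure. f (domain_section (\<Omega>s r) y))" .
qed

lemma measure_tile: "measure lebesgue \<Omega> = real CARD('k) * measure lebesgue Cell"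
proof -
  interpret finite_measure tile_measure by (rule finite_tile_measure)
  show ?thesis
    using integral_tile(2)[of "\<lambda>x. 1 :: real"] sets_tile sets_cell
    by (simp add: measure_restrict_space space_restrict_space)
qed

text \<open>Completeness of the measure again: the dual family is prescribed only almost everywhere,
  so its measurability has to come from an explicit representative.\<close>

lemma borel_measurable_tile_AE:
  fixes f h :: "real^'d \<Rightarrow> complex"
  assumes "f \<in> borel_measurable tile_measure" "AE x in tile_measure. f x = h x"
  shows "h \<in> borel_measurable tile_measure"
proof -
  have "(\<lambda>x. indicator \<Omega> x *\<^sub>R f x) \<in> borel_measurable lebesgue"
    using assms(1) sets_tile by (simp add: borel_measurable_restrict_space_iff)
  moreover have "AE x in lebesgue. indicator \<Omega> x *\<^sub>R f x = indicator \<Omega> x *\<^sub>R h x"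
    using assms(2) sets_tile by (auto simp: AE_restrict_space_iff indicator_def elim!: eventually_mono)
  ultimately have "(\<lambda>x. indicator \<Omega> x *\<^sub>R h x) \<in> borel_measurable lebesgue"
    by (rule borel_measurable_AE)
  then show ?thesis using sets_tile by (simp add: borel_measurable_restrict_space_iff)
qed

lemma borel_measurable_tile_pieces:
  fixes w :: "'k \<Rightarrow> real^'d \<Rightarrow> complex"
  assumes w: "\<And>r. w r \<in> borel_measurable cell_measure"
  shows "(\<lambda>x. \<Sum>r\<in>UNIV. indicator (\<Omega>s r) x *\<^sub>R w r (reduce x)) \<in> borel_measurable tile_measure"
proof (intro borel_measurable_sum)
  fix r
  have "(\<lambda>x. w r (reduce x)) \<in> borel_measurable (lebesgue_on (\<Omega>s r))"
    by (rule measurable_compose[OF measurable_reduce[OF domains] w])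
  then have "(\<lambda>x. indicator (\<Omega>s r) x *\<^sub>R w r (reduce x)) \<in> borel_measurable lebesgue"
    using sets_tile by (simp add: borel_measurable_restrict_space_iff)
  then show "(\<lambda>x. indicator (\<Omega>s r) x *\<^sub>R w r (reduce x)) \<in> borel_measurable tile_measure"
    by (rule measurable_restrict_space1)
qed

lemma AE_tile_part_regular:
  "AE x in lebesgue_on (\<Omega>s r). x \<in> \<Omega>s r \<and> (\<forall>q. x \<in> regular (\<Omega>s q))"
proof -
  have "AE x in lebesgue. \<forall>q. x \<in> regular (\<Omega>s q)"
    using AE_regular[OF domains] by (subst AE_all_countable) blast
  then show ?thesis
    using sets_tile by (subst AE_restrict_space_iff) (auto elim: eventually_mono)
qed

lemma reduce_domain_section:
  assumes "y \<in> Cell" "y \<in> regular (\<Omega>s r)"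
  shows "reduce (domain_section (\<Omega>s r) y) = y"
  using assms lattice_shift_in_lattice[OF domains]
  by (intro reduce_eqI) (auto simp: domain_section_def[OF domains])

text \<open>The common core of both halves of the theorem: a family given on almost all of each part
  by a matrix function of the reduced point. Transporting the formula along the sections brings it
  into the form required by \<open>riesz_basis_fibres\<close>.\<close>

lemma riesz_basis_tile:
  fixes a :: "'k \<Rightarrow> real^'d" and W U :: "real^'d \<Rightarrow> complex^'k^'k"
  assumes L: "L = (\<Union>s. (\<lambda>l. l + a s) ` dual_lattice M)"
    and inj: "\<And>l l' s s'. l \<in> dual_lattice M \<Longrightarrow> l' \<in> dual_lattice M \<Longrightarrow>
      l + a s = l' + a s' \<Longrightarrow> l = l' \<and> s = s'"
    and h: "\<And>l s r. l \<in> dual_lattice M \<Longrightarrow>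
      AE x in lebesgue_on (\<Omega>s r). h (l + a s) x = W (reduce x) $ r $ s * expo l (reduce x)"
    and W: "\<And>r s. (\<lambda>y. W y $ r $ s) \<in> borel_measurable cell_measure"
    and U: "\<And>r s. (\<lambda>y. U y $ r $ s) \<in> borel_measurable cell_measure"
    and bounded: "AE y in cell_measure. \<forall>r s. cmod (W y $ r $ s) \<le> K"
      "AE y in cell_measure. \<forall>r s. cmod (U y $ r $ s) \<le> K"
    and inverse: "AE y in cell_measure. W y ** U y = mat 1 \<and> U y ** W y = mat 1"
    and K: "0 < K"
  shows "\<And>l. l \<in> L \<Longrightarrow> h l \<in> L2_fun tile_measure"
    and "\<And>l s r. l \<in> dual_lattice M \<Longrightarrow>
      AE y in cell_measure. h (l + a s) (domain_section (\<Omega>s r) y) = W y $ r $ s * expo l y"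
    and "riesz_basis tile_measure L h"
proof -
  interpret finite_measure tile_measure by (rule finite_tile_measure)
  show L2: "h l' \<in> L2_fun tile_measure" if mem: "l' \<in> L" for l'
  proof -
    obtain l s where l: "l \<in> dual_lattice M" "l' = l + a s" using mem unfolding L by blast
    have meas: "h l' \<in> borel_measurable tile_measure"
    proof (rule borel_measurable_tile_AE)
      show "(\<lambda>x. \<Sum>r\<in>UNIV. indicator (\<Omega>s r) x *\<^sub>R (W (reduce x) $ r $ s * expo l (reduce x)))
          \<in> borel_measurable tile_measure"
        using W borel_measurable_expo by (intro borel_measurable_tile_pieces borel_measurable_times)
      show "AE x in tile_measure. (\<Sum>r\<in>UNIV. indicator (\<Omega>s r) x *\<^sub>R (W (reduce x) $ r $ s * expo l (reduce x))) = h l' x"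
        unfolding AE_tile_iff
      proof
        fix q
        show "AE x in lebesgue_on (\<Omega>s q). (\<Sum>r\<in>UNIV. indicator (\<Omega>s r) x *\<^sub>R
            (W (reduce x) $ r $ s * expo l (reduce x))) = h l' x"
          using h[OF l(1), where r = q and s = s] AE_tile_part_regular[of q]
        proof eventually_elim
          case (elim x)
          then have "indicator (\<Omega>s r) x *\<^sub>R (W (reduce x) $ r $ s * expo l (reduce x)) =
              (if r = q then W (reduce x) $ q $ s * expo l (reduce x) else 0)" for r
            using disjoint by (auto simp: disjoint_family_on_def indicator_def)
          then show ?case using elim l(2) by simp
        qed
      qed
    qed
    show ?thesis
    proof (rule L2_fun_dominated[OF meas])
      show "integrable tile_measure (\<lambda>x. K\<^sup>2)" by simp
      show "AE x in tile_measure. (cmod (h l' x))\<^sup>2 \<le> K\<^sup>2"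
        unfolding AE_tile_iff
      proof
        fix q
        show "AE x in lebesgue_on (\<Omega>s q). (cmod (h l' x))\<^sup>2 \<le> K\<^sup>2"
          using h[OF l(1), where r = q and s = s] AE_tile_part_reduce[OF bounded(1), of q]
          by eventually_elim (auto simp: l(2) norm_mult intro!: power_mono)
      qed
    qed
  qed
  show hW: "AE y in cell_measure. h (l + a s) (domain_section (\<Omega>s r) y) = W y $ r $ s * expo l y"
    if "l \<in> dual_lattice M" for l s r
    using AE_domain_section[OF h[OF that, where r = r and s = s]] AE_regular_cell[OF domains[of r]]
    by eventually_elim (simp add: reduce_domain_section)
  show "riesz_basis tile_measure L h"
  proof (rule riesz_basis_fibres[where \<iota> = "\<lambda>l s. l + a s" and \<omega> = "\<lambda>r. domain_section (\<Omega>s r)"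
        and W = W and U = U])
    show "orthogonal_basis cell_measure (dual_lattice M) expo (measure lebesgue Cell)"
      by (rule orthogonal_basis_expo)
    show "countable (dual_lattice M)" by (rule countable_dual_lattice)
    show "domain_section (\<Omega>s r) \<in> measurable cell_measure tile_measure" for r
      by (rule measurable_section_tile)
    show "(\<forall>r. integrable cell_measure (\<lambda>y. f (domain_section (\<Omega>s r) y))) \<and>
        (LINT x|tile_measure. f x) = (\<Sum>r\<in>UNIV. LINT y|cell_measure. f (domain_section (\<Omega>s r) y))"
      if "integrable tile_measure f" for f :: "real^'d \<Rightarrow> real"
      using integral_tile[OF that] by blast
  qed (fact L inj L2 hW U bounded inverse K)+
qed

section \<open>Exponentials on the tile in terms of V\<close>

lemma V_matrix_entry: "V_matrix \<Lambda> \<Omega>s a y $ s $ r = cnj (expo (a s) (lattice_shift \<Lambda> (\<Omega>s r) y))"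
  by (simp add: V_matrix_def expo_def exp_cnj inner_commute)

lemma borel_measurable_V_matrix:
  "(\<lambda>y. V_matrix \<Lambda> \<Omega>s a y $ s $ r) \<in> borel_measurable cell_measure"
  unfolding V_matrix_entry
  by (intro borel_measurable_cnj measurable_compose[OF borel_measurable_lattice_shift[OF domains]]
      borel_measurable_continuous_onI continuous_expo)

text \<open>Write x as y plus its shift, with y in the cell. The exponential of l does not see the
  shift, and that of a_s picks up exactly the conjugate of the entry of V.\<close>

lemma expo_tile_part:
  assumes x: "x \<in> \<Omega>s r" "x \<in> regular (\<Omega>s r)" and l: "l \<in> dual_lattice M"
  shows "expo (l + a s) x =
    expo (a s) (reduce x) * cnj (V_matrix \<Lambda> \<Omega>s a (reduce x) $ s $ r) * expo l (reduce x)"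
proof -
  have "domain_section (\<Omega>s r) (reduce x) = x"
    by (rule domain_section_reduce[OF domains x])
  moreover have "reduce x \<in> regular (\<Omega>s r)"
    by (rule reduce_regular[OF domains x(2)])
  ultimately have "reduce x + lattice_shift \<Lambda> (\<Omega>s r) (reduce x) = x"
    by (simp add: domain_section_def[OF domains])
  then have "expo (a s) x = expo (a s) (reduce x) * expo (a s) (lattice_shift \<Lambda> (\<Omega>s r) (reduce x))"
    using expo_add_right[of "a s" "reduce x"] by metis
  then show ?thesis
    by (simp add: V_matrix_entry expo_add_left expo_reduce[OF l])
qed

end

theorem theorem2p1:
  fixes M :: "real^'d^'d"
    and \<Omega> E :: "(real^'d) set"
    and \<Omega>s :: "'k::finite \<Rightarrow> (real^'d) set"
    and a :: "'k \<Rightarrow> real^'d"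
    and \<alpha> \<beta> :: real
    and L :: "(real^'d) set"
    and g :: "real^'d \<Rightarrow> real^'d \<Rightarrow> complex"
  assumes M: "invertible M"
    and tile: "k_tile CARD('k) (lattice M) \<Omega>"
    and partition: "\<Omega> = (\<Union>r. \<Omega>s r) \<union> E"
    and disjoint: "disjoint_family \<Omega>s" "\<And>r. \<Omega>s r \<inter> E = {}"
    and null: "E \<in> null_sets lebesgue"
    and domains: "\<And>r. fundamental_domain (lattice M) (\<Omega>s r)"
    and bounds: "0 < \<alpha>" "\<alpha> \<le> \<beta>"
    and singular: "AE x\<in>fund_parallelepiped M in lebesgue.
           \<forall>\<sigma>\<in>singular_values (V_matrix (lattice M) \<Omega>s a x). \<alpha> < \<sigma> \<and> \<sigma> < \<beta>"
    and L: "L = (\<Union>s. (\<lambda>l. l + a s) ` dual_lattice M)"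
    and g: "\<And>l s. l \<in> dual_lattice M \<Longrightarrow>
           AE x in lebesgue_on \<Omega>. g (l + a s) x =
             expo (l + a s) x *
             (of_nat CARD('k) *
               (\<Sum>r\<in>UNIV.
                  V_matrix (lattice M) \<Omega>s a (shift_back M (\<Omega>s r) x) $ s $ r *
                  matrix_inv (V_matrix (lattice M) \<Omega>s a (shift_back M (\<Omega>s r) x)) $ r $ s *
                  indicator (\<Omega>s r) x))"
  shows "riesz_basis (lebesgue_on \<Omega>) L expo \<and>
         riesz_basis (lebesgue_on \<Omega>) L g \<and>
         biorthogonal \<Omega> L expo g"
proof -
  interpret multi_tile M \<Omega> E \<Omega>s
    using M tile partition disjoint(1) null domains
    by unfold_locales (auto simp: k_tile_def fmeasurable_def)
  interpret orthogonal_basis cell_measure "dual_lattice M" expo "measure lebesgue Cell"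
    by (rule orthogonal_basis_expo)
  define V where "V = V_matrix \<Lambda> \<Omega>s a"
  \<comment> \<open>Cramer's rule, because the values of \<open>matrix_inv\<close> on singular matrices are arbitrary and
    need not be measurable.\<close>
  define J :: "real^'d \<Rightarrow> complex^'k^'k" where
    "J y = (\<chi> r s. det (\<chi> i j. if j = r then axis s 1 $ i else V y $ i $ j) / det (V y))" for y
  have V_meas: "(\<lambda>y. V y $ s $ r) \<in> borel_measurable cell_measure" for r s
    unfolding V_def by (rule borel_measurable_V_matrix)
  have norm_V: "cmod (V y $ s $ r) = 1" for y s r
    by (simp add: V_def V_matrix_entry)
  have J_meas: "(\<lambda>y. J y $ r $ s) \<in> borel_measurable cell_measure" for r s
  proof -
    have "(\<lambda>y. if j = r then axis s 1 $ i else V y $ i $ j) \<in> borel_measurable cell_measure" for i j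
      by (cases "j = r") (auto intro: V_meas)
    then show ?thesis
      unfolding J_def using V_meas by (auto intro!: borel_measurable_divide borel_measurable_det)
  qed
  have inv: "AE y in cell_measure. V y ** J y = mat 1 \<and> J y ** V y = mat 1 \<and>
      matrix_inv (V y) = J y \<and> (\<forall>r s. cmod (J y $ r $ s) \<le> 1 / \<alpha>)"
  proof -
    have "AE y in cell_measure. \<forall>\<sigma>\<in>singular_values (V y). \<alpha> < \<sigma> \<and> \<sigma> < \<beta>"
      using singular sets_cell unfolding V_def by (simp add: AE_restrict_space_iff)
    then show ?thesis
    proof eventually_elim
      case (elim y)
      then have sv: "\<And>\<sigma>. \<sigma> \<in> singular_values (V y) \<Longrightarrow> \<alpha> < \<sigma>" by blast
      have inv: "V y ** matrix_inv (V y) = mat 1" "matrix_inv (V y) ** V y = mat 1"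
        "\<And>r s. cmod (matrix_inv (V y) $ r $ s) \<le> 1 / \<alpha>"
        using matrix_inv_singular_values[of \<alpha> "V y"] bounds(1) sv by blast+
      have "matrix_inv (V y) = J y"
        using matrix_inv_cramer[OF inv(1)] by (simp add: vec_eq_iff J_def)
      then show ?case using inv by simp
    qed
  qed
  have inj: "l = l' \<and> s = s'"
    if l: "l \<in> dual_lattice M" "l' \<in> dual_lattice M" "l + a s = l' + a s'" for l l' s s'
  proof -
    \<comment> \<open>The cell has positive measure, so an almost everywhere statement holds at some
      point, and V is invertible there.\<close>
    have "ae_filter cell_measure \<noteq> bot"
      using sets_cell measure_cell_pos
      by (auto simp: ae_filter_eq_bot_iff space_cell_measure emeasure_restrict_space measure_def)
    from eventually_happens'[OF this inv] obtain y where y: "V y ** J y = mat 1" by blast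
    \<comment> \<open>On lattice vectors the dual lattice parts of the frequencies are invisible, so
      equal frequencies give equal rows of V. Then rows s and s' of the identity V J agree, which
      forces s = s'.\<close>
    have "V y $ s $ r = V y $ s' $ r" for r
    proof -
      let ?x = "lattice_shift \<Lambda> (\<Omega>s r) y"
      have x: "?x \<in> \<Lambda>" by (rule lattice_shift_in_lattice[OF domains])
      have "expo (l + a s) ?x = expo (l' + a s') ?x" using l(3) by simp
      then show ?thesis
        by (simp add: V_def V_matrix_entry expo_add_left expo_periodic[OF l(1) x] expo_periodic[OF l(2) x])
    qed
    then have "(V y ** J y) $ s $ s = (V y ** J y) $ s' $ s"
      by (simp add: matrix_matrix_mult_def)
    then have "s = s'" unfolding y by (simp add: mat_def split: if_splits)
    then show ?thesis using l(3) by simp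
  qed
  define k where "k = complex_of_nat CARD('k)"
  have k: "k \<noteq> 0" by (simp add: k_def)
  have norm_k: "cmod k = real CARD('k)" by (simp add: k_def)
  have k1: "1 \<le> real CARD('k)"
    using zero_less_card_finite[where 'a = 'k] by linarith
  \<comment> \<open>One constant for all four matrix functions: entries of W1 have modulus 1 and
    those of U2 modulus 1/k, while the bound 1 / \<alpha> on J gives 1 / \<alpha> for U1 and k /
    \<alpha> for W2.\<close>
  define K where "K = 1 + 1 / \<alpha> + real CARD('k) / \<alpha>"
  have "0 \<le> 1 / \<alpha>" "0 \<le> real CARD('k) / \<alpha>" using bounds(1) by simp_all
  then have K: "0 < K" "1 \<le> K" "1 / \<alpha> \<le> K" "real CARD('k) / \<alpha> \<le> K"
    unfolding K_def by linarith+
  have expo_unit: "expo l x * cnj (expo l x) = 1" "cnj (expo l x) * expo l x = 1" for l x :: "real^'d"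
    using complex_norm_square[of "expo l x"] by (simp_all add: mult.commute)
  have expo_meas: "(\<lambda>y. cnj (expo l y)) \<in> borel_measurable cell_measure" for l
    by (intro borel_measurable_cnj borel_measurable_expo)

  \<comment> \<open>W1 is the conjugate transpose of V with column s multiplied by the unimodular
    e_{a_s}, and W2 is k times the inverse of V with the same column factors. U1 and U2 are their
    inverses, with the conjugate factors on the rows.\<close>
  define W1 :: "real^'d \<Rightarrow> complex^'k^'k" where "W1 y = (\<chi> r s. expo (a s) y * cnj (V y $ s $ r))" for y
  define U1 :: "real^'d \<Rightarrow> complex^'k^'k" where "U1 y = (\<chi> s r. cnj (expo (a s) y) * cnj (J y $ r $ s))" for y
  define W2 :: "real^'d \<Rightarrow> complex^'k^'k" where "W2 y = (\<chi> r s. k * expo (a s) y * J y $ r $ s)" for y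
  define U2 :: "real^'d \<Rightarrow> complex^'k^'k" where "U2 y = (\<chi> s r. cnj (expo (a s) y) * V y $ s $ r / k)" for y
  have J_V: "(\<Sum>s\<in>UNIV. J y $ r $ s * V y $ s $ r') = (if r = r' then 1 else 0)" if "J y ** V y = mat 1" for y r r'
  proof -
    have "(\<Sum>s\<in>UNIV. J y $ r $ s * V y $ s $ r') = (J y ** V y) $ r $ r'"
      by (simp add: matrix_matrix_mult_def)
    then show ?thesis unfolding that by (simp add: mat_def)
  qed
  have V_J: "(\<Sum>r\<in>UNIV. V y $ s $ r * J y $ r $ s') = (if s = s' then 1 else 0)" if "V y ** J y = mat 1" for y s s'
  proof -
    have "(\<Sum>r\<in>UNIV. V y $ s $ r * J y $ r $ s') = (V y ** J y) $ s $ s'"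
      by (simp add: matrix_matrix_mult_def)
    then show ?thesis unfolding that by (simp add: mat_def)
  qed
  have inv1: "AE y in cell_measure. W1 y ** U1 y = mat 1 \<and> U1 y ** W1 y = mat 1"
    using inv
  proof eventually_elim
    case (elim y)
    have "W1 y ** U1 y = mat 1"
    proof -
      have "(W1 y ** U1 y) $ r $ r' = cnj (\<Sum>s\<in>UNIV. J y $ r' $ s * V y $ s $ r)" for r r'
      proof -
        have "(W1 y ** U1 y) $ r $ r' =
            (\<Sum>s\<in>UNIV. (expo (a s) y * cnj (expo (a s) y)) * cnj (J y $ r' $ s * V y $ s $ r))"
          by (simp add: W1_def U1_def matrix_matrix_mult_def mult_ac)
        then show ?thesis unfolding expo_unit by simp
      qed
      then show ?thesis using J_V elim by (auto simp: vec_eq_iff mat_def)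
    qed
    then show ?case using matrix_left_right_inverse by blast
  qed
  have inv2: "AE y in cell_measure. W2 y ** U2 y = mat 1 \<and> U2 y ** W2 y = mat 1"
    using inv
  proof eventually_elim
    case (elim y)
    have "W2 y ** U2 y = mat 1"
    proof -
      have "(W2 y ** U2 y) $ r $ r' = (\<Sum>s\<in>UNIV. J y $ r $ s * V y $ s $ r')" for r r'
      proof -
        have "(W2 y ** U2 y) $ r $ r' =
            (\<Sum>s\<in>UNIV. (expo (a s) y * cnj (expo (a s) y)) * (J y $ r $ s * V y $ s $ r'))"
          using k by (simp add: W2_def U2_def matrix_matrix_mult_def mult_ac)
        then show ?thesis unfolding expo_unit by simp
      qed
      then show ?thesis using J_V elim by (simp add: vec_eq_iff mat_def)
    qed
    then show ?case using matrix_left_right_inverse by blast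
  qed

  have h1: "AE x in lebesgue_on (\<Omega>s r). expo (l + a s) x = W1 (reduce x) $ r $ s * expo l (reduce x)"
    if "l \<in> dual_lattice M" for l s r
    using AE_tile_part_regular[of r]
    by eventually_elim (simp add: expo_tile_part that W1_def V_def)
  have h2: "AE x in lebesgue_on (\<Omega>s r). g (l + a s) x = W2 (reduce x) $ r $ s * expo l (reduce x)"
    if l: "l \<in> dual_lattice M" for l s r
  proof -
    have "AE x in lebesgue_on (\<Omega>s r). g (l + a s) x = expo (l + a s) x * (of_nat CARD('k) *
          (\<Sum>r\<in>UNIV. V (shift_back M (\<Omega>s r) x) $ s $ r *
             matrix_inv (V (shift_back M (\<Omega>s r) x)) $ r $ s * indicator (\<Omega>s r) x))"
      using g[OF l, of s] unfolding AE_tile_iff V_def by blast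
    then show ?thesis
      using AE_tile_part_regular[of r] AE_tile_part_reduce[OF inv, of r]
    proof eventually_elim
      case (elim x)
      let ?y = "reduce x"
      have sb: "shift_back M (\<Omega>s r) x = ?y"
        using elim shift_back_eq_reduce[OF domains] by blast
      \<comment> \<open>On \<Omega>_r disjointness leaves only the summand with index r, and there
        \<open>shift_back\<close> is \<open>reduce\<close>.\<close>
      have "V (shift_back M (\<Omega>s q) x) $ s $ q * matrix_inv (V (shift_back M (\<Omega>s q) x)) $ q $ s *
          indicator (\<Omega>s q) x = (if q = r then V ?y $ s $ r * J ?y $ r $ s else 0)" for q
        using elim disjoint(1) sb by (auto simp: disjoint_family_on_def indicator_def)
      then have "g (l + a s) x = expo (l + a s) x * (k * (V ?y $ s $ r * J ?y $ r $ s))"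
        using elim by (simp add: k_def)
      also have "expo (l + a s) x = expo (a s) ?y * cnj (V ?y $ s $ r) * expo l ?y"
        using elim by (simp add: expo_tile_part l V_def)
      also have "\<dots> * (k * (V ?y $ s $ r * J ?y $ r $ s)) =
          (V ?y $ s $ r * cnj (V ?y $ s $ r)) * (k * expo (a s) ?y * J ?y $ r $ s * expo l ?y)"
        by (simp add: mult_ac)
      \<comment> \<open>The factor V_sr built into \<open>g\<close> meets the conjugate entry from
        \<open>expo_tile_part\<close>; as V_sr is unimodular, only the entry of the inverse
        remains.\<close>
      also have "V ?y $ s $ r * cnj (V ?y $ s $ r) = 1"
        by (simp add: norm_V complex_norm_square[symmetric])
      finally show ?case by (simp add: W2_def)
    qed
  qed
  have bounded1: "AE y in cell_measure. \<forall>r s. cmod (W1 y $ r $ s) \<le> K"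
    "AE y in cell_measure. \<forall>r s. cmod (U1 y $ r $ s) \<le> K"
  proof -
    show "AE y in cell_measure. \<forall>r s. cmod (W1 y $ r $ s) \<le> K"
      using K(2) by (simp add: W1_def norm_mult norm_V)
    show "AE y in cell_measure. \<forall>r s. cmod (U1 y $ r $ s) \<le> K"
      using inv
    proof eventually_elim
      case (elim y)
      have "cmod (J y $ r $ s) \<le> 1 / \<alpha>" for r s using elim by blast
      then have "cmod (J y $ r $ s) \<le> K" for r s using K(3) by (rule order_trans)
      then show ?case by (simp add: U1_def norm_mult)
    qed
  qed
  have bounded2: "AE y in cell_measure. \<forall>r s. cmod (W2 y $ r $ s) \<le> K"
    "AE y in cell_measure. \<forall>r s. cmod (U2 y $ r $ s) \<le> K"
  proof -
    show "AE y in cell_measure. \<forall>r s. cmod (W2 y $ r $ s) \<le> K"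
      using inv
    proof eventually_elim
      case (elim y)
      have "real CARD('k) * cmod (J y $ r $ s) \<le> K" for r s
      proof -
        have "cmod (J y $ r $ s) \<le> 1 / \<alpha>" using elim by blast
        then have "real CARD('k) * cmod (J y $ r $ s) \<le> real CARD('k) * (1 / \<alpha>)"
          by (rule mult_left_mono) simp
        then show ?thesis using K(4) by simp
      qed
      then show ?case by (simp add: W2_def norm_mult norm_k)
    qed
    have "1 / real CARD('k) \<le> 1" using k1 by simp
    then have "1 / real CARD('k) \<le> K" using K(2) by (rule order_trans)
    then show "AE y in cell_measure. \<forall>r s. cmod (U2 y $ r $ s) \<le> K"
      by (simp add: U2_def norm_mult norm_divide norm_V norm_k)
  qed
  have meas: "(\<lambda>y. W1 y $ r $ s) \<in> borel_measurable cell_measure" "(\<lambda>y. U1 y $ r $ s) \<in> borel_measurable cell_measure"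
    "(\<lambda>y. W2 y $ r $ s) \<in> borel_measurable cell_measure" "(\<lambda>y. U2 y $ r $ s) \<in> borel_measurable cell_measure" for r s
    unfolding W1_def U1_def W2_def U2_def vec_lambda_beta
    by (intro borel_measurable_times borel_measurable_divide borel_measurable_cnj borel_measurable_const
        V_meas J_meas borel_measurable_expo)+
  have R1: "(\<forall>l\<in>L. expo l \<in> L2_fun tile_measure) \<and>
    (\<forall>l\<in>dual_lattice M. \<forall>s r.
      AE y in cell_measure. expo (l + a s) (domain_section (\<Omega>s r) y) = W1 y $ r $ s * expo l y) \<and>
    riesz_basis tile_measure L expo"
    by (intro conjI ballI allI; rule riesz_basis_tile[where h = expo and W = W1 and U = U1 and K = K and a = a and L = L];
        (assumption | rule L meas(1,2) bounded1 inv1 K(1) | (rule inj h1; assumption)))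
  have R2: "(\<forall>l\<in>L. g l \<in> L2_fun tile_measure) \<and>
    (\<forall>l\<in>dual_lattice M. \<forall>s r.
      AE y in cell_measure. g (l + a s) (domain_section (\<Omega>s r) y) = W2 y $ r $ s * expo l y) \<and>
    riesz_basis tile_measure L g"
    by (intro conjI ballI allI; rule riesz_basis_tile[where h = g and W = W2 and U = U2 and K = K and a = a and L = L];
        (assumption | rule L meas(3,4) bounded2 inv2 K(1) | (rule inj h2; assumption)))
  have "biorthogonal \<Omega> L expo g"
    unfolding biorthogonal_def
  proof (intro ballI)
    fix l1 l2 assume l12: "l1 \<in> L" "l2 \<in> L"
    then obtain l s l' s' where l: "l \<in> dual_lattice M" "l1 = l + a s" "l' \<in> dual_lattice M" "l2 = l' + a s'"
      unfolding L by blast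
    have int: "integrable tile_measure (\<lambda>x. expo l1 x * cnj (g l2 x))"
      using R1 R2 l12 by (intro L2_fun_integrable_inner) simp_all
    have "L2_inner_on tile_measure (expo l1) (g l2) =
       (\<Sum>r\<in>UNIV. LINT y|cell_measure. expo l1 (domain_section (\<Omega>s r) y) * cnj (g l2 (domain_section (\<Omega>s r) y)))"
      unfolding L2_inner_on_def by (rule integral_tile(2)[OF int])
    also have "\<dots> = (LINT y|cell_measure. (\<Sum>r\<in>UNIV. expo l1 (domain_section (\<Omega>s r) y) *
        cnj (g l2 (domain_section (\<Omega>s r) y))))"
      by (rule Bochner_Integration.integral_sum[symmetric]) (rule integral_tile(1)[OF int])
    also have "\<dots> = (LINT y|cell_measure. (if s = s' then k else 0) * (expo l y * cnj (expo l' y)))"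
    proof (rule integral_cong_AE)
      show "(\<lambda>y. \<Sum>r\<in>UNIV. expo l1 (domain_section (\<Omega>s r) y) * cnj (g l2 (domain_section (\<Omega>s r) y)))
          \<in> borel_measurable cell_measure"
        by (intro borel_measurable_sum borel_measurable_integrable integral_tile(1)[OF int])
      show "(\<lambda>y. (if s = s' then k else 0) * (expo l y * cnj (expo l' y))) \<in> borel_measurable cell_measure"
        using expo_meas borel_measurable_expo by (auto intro!: borel_measurable_times)
      have "AE y in cell_measure. \<forall>r. expo l1 (domain_section (\<Omega>s r) y) = W1 y $ r $ s * expo l y"
        using R1 l(1) unfolding l(2) by (simp add: AE_all_countable)
      moreover have "AE y in cell_measure. \<forall>r. g l2 (domain_section (\<Omega>s r) y) = W2 y $ r $ s' * expo l' y"
        using R2 l(3) unfolding l(4) by (simp add: AE_all_countable)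
      ultimately show "AE y in cell_measure.
          (\<Sum>r\<in>UNIV. expo l1 (domain_section (\<Omega>s r) y) * cnj (g l2 (domain_section (\<Omega>s r) y))) =
          (if s = s' then k else 0) * (expo l y * cnj (expo l' y))"
        using inv
      proof eventually_elim
        case (elim y)
        \<comment> \<open>The r-dependent factors collect into the conjugate of the entry (s, s') of
          V J, so the sum vanishes unless s = s', and then the exponentials of a_s cancel.\<close>
        have "(\<Sum>r\<in>UNIV. expo l1 (domain_section (\<Omega>s r) y) * cnj (g l2 (domain_section (\<Omega>s r) y))) =
          (\<Sum>r\<in>UNIV. (k * (expo (a s) y * cnj (expo (a s') y)) * (expo l y * cnj (expo l' y))) *
             cnj (V y $ s $ r * J y $ r $ s'))"
          using elim by (intro sum.cong refl) (simp add: W1_def W2_def k_def mult_ac)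
        also have "\<dots> = (k * (expo (a s) y * cnj (expo (a s') y)) * (expo l y * cnj (expo l' y))) *
            cnj (if s = s' then 1 else 0)"
          unfolding sum_distrib_left[symmetric] cnj_sum[symmetric] using V_J elim by simp
        finally show ?case using expo_unit by simp
      qed
    qed
    also have "\<dots> = (if s = s' then k else 0) * L2_inner_on cell_measure (expo l) (expo l')"
      unfolding L2_inner_on_def by simp
    \<comment> \<open>The product k times the volume of the cell is the volume of \<Omega> by
      \<open>measure_tile\<close>, and \<open>inj\<close> translates equality of the pairs (l, s)
      and (l', s') into equality of frequencies.\<close>
    also have "\<dots> = (if l1 = l2 then of_real (measure lebesgue \<Omega>) else 0)"
      using inj[OF l(1) l(3), of s s'] e_orthogonal[OF l(1) l(3)]
      by (auto simp: l measure_tile k_def)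
    finally show "L2_inner_on tile_measure (expo l1) (g l2) =
        (if l1 = l2 then of_real (measure lebesgue \<Omega>) else 0)" .
  qed
  then show ?thesis using R1 R2 by blast
qed

end
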